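(* Let $\mathcal{L}$ be a continuous signature and let $T$ be an $\mathcal{L}$-theory that is primitive and admits quantifier elimination. Suppose $\mathcal{M}\models T$ and $f:M^n\to M$ is a definable function. Then for any $\epsilon>0$, there are finitely many $\mathcal{L}(M)$-terms $t_1(\vec x),\ldots,t_k(\vec x)$ such that for all $\vec a\in M^n$ there is $i\in\{1,\ldots,k\}$ with $d(f(\vec a),t_i(\vec a))\le\epsilon$.
   Context: Standard continuous first-order logic (Ben Yaacov--Berenstein--Henson--Usvyatsov), with formulas valued in $[0,1]$. A closed condition is $\sigma=0$ with $\sigma$ a sentence; a theory is a set of closed conditions. A condition $\sigma=0$ is universal if $\sigma$ has the form $\sup_{\vec x}\varphi(\vec x)$, and existential if $\sigma$ has the form $\inf_{\vec x}\varphi(\vec x)$, with $\varphi$ quantifier-free. $T$ is primitive if there are a set $\Gamma$ of universal closed conditions and a set $\Delta$ of existential closed conditions such that $\Gamma\cup\Delta$ axiomatizes $T$. $T$ admits quantifier elimination if every formula can be approximated, uniformly over all models of $T$ and to within any $\delta>0$, by quantifier-free formulas in the same variables. $\mathcal{L}(M)$ is $\mathcal{L}$ with constants added for the elements of $M$. A function $f:M^n\to M$ is definable (with parameters from $M$) if the predicate $(\vec x,y)\mapsto d(f(\vec x),y)$ on $M^{n+1}$ is a uniform limit of interpretations of $\mathcal{L}(M)$-formulas. *)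

theory Defs
  imports "HOL-Analysis.Analysis"
begin

section \<open>Signatures and metric structures\<close>

text \<open>Constants are function symbols of arity 0. The symbols are carved out of the types
  \<open>'f\<close> and \<open>'p\<close> by \<open>funs\<close> and \<open>preds\<close>, so that a signature may have no function symbols
  or no predicate symbols (besides the metric).\<close>

record ('f, 'p) signature =
  funs :: "'f set"
  preds :: "'p set"
  fun_arity :: "'f \<Rightarrow> nat"
  pred_arity :: "'p \<Rightarrow> nat"
  fun_modulus :: "'f \<Rightarrow> real \<Rightarrow> real"
  pred_modulus :: "'p \<Rightarrow> real \<Rightarrow> real"

definition is_modulus :: "(real \<Rightarrow> real) \<Rightarrow> bool" where
  "is_modulus \<Delta> \<longleftrightarrow> (\<forall>\<epsilon>\<in>{0<..1}. \<Delta> \<epsilon> \<in> {0<..1})"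

definition is_signature :: "('f, 'p) signature \<Rightarrow> bool" where
  "is_signature L \<longleftrightarrow>
     (\<forall>F\<in>funs L. is_modulus (fun_modulus L F)) \<and>
     (\<forall>P\<in>preds L. is_modulus (pred_modulus L P))"

record ('f, 'p, 'a) metric_structure =
  points :: "'a set"
  metric :: "'a \<Rightarrow> 'a \<Rightarrow> real"
  fun_interp :: "'f \<Rightarrow> 'a list \<Rightarrow> 'a"
  pred_interp :: "'p \<Rightarrow> 'a list \<Rightarrow> real"

definition tuples :: "'a set \<Rightarrow> nat \<Rightarrow> 'a list set" where
  "tuples A n = {xs. length xs = n \<and> set xs \<subseteq> A}"

text \<open>Tuples carry the maximum metric: the tuples \<open>xs\<close> and \<open>ys\<close> are at distance less than
  \<open>r > 0\<close> iff all their coordinates are.\<close>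

definition is_structure :: "('f, 'p) signature \<Rightarrow> ('f, 'p, 'a) metric_structure \<Rightarrow> bool" where
  "is_structure L M \<longleftrightarrow>
     points M \<noteq> {} \<and>
     Metric_space (points M) (metric M) \<and>
     Metric_space.mcomplete (points M) (metric M) \<and>
     (\<forall>x\<in>points M. \<forall>y\<in>points M. metric M x y \<le> 1) \<and>
     (\<forall>F\<in>funs L.
        (\<forall>xs\<in>tuples (points M) (fun_arity L F). fun_interp M F xs \<in> points M) \<and>
        (\<forall>\<epsilon>\<in>{0<..1}. \<forall>xs\<in>tuples (points M) (fun_arity L F). \<forall>ys\<in>tuples (points M) (fun_arity L F).
           (\<forall>i<fun_arity L F. metric M (xs ! i) (ys ! i) < fun_modulus L F \<epsilon>) \<longrightarrow>
           metric M (fun_interp M F xs) (fun_interp M F ys) \<le> \<epsilon>)) \<and>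
     (\<forall>P\<in>preds L.
        (\<forall>xs\<in>tuples (points M) (pred_arity L P). pred_interp M P xs \<in> {0..1}) \<and>
        (\<forall>\<epsilon>\<in>{0<..1}. \<forall>xs\<in>tuples (points M) (pred_arity L P). \<forall>ys\<in>tuples (points M) (pred_arity L P).
           (\<forall>i<pred_arity L P. metric M (xs ! i) (ys ! i) < pred_modulus L P \<epsilon>) \<longrightarrow>
           \<bar>pred_interp M P xs - pred_interp M P ys\<bar> \<le> \<epsilon>))"

section \<open>Terms and formulas\<close>

datatype 'f trm = Var nat | App 'f "'f trm list"

text \<open>A connective is an arbitrary continuous function \<open>[0,1]\<^sup>n \<rightarrow> [0,1]\<close>, taken here as a
  function on lists; continuity is imposed in \<open>is_connective\<close> and \<open>wf_fm\<close>.\<close>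

datatype ('f, 'p) fm =
    Dist "'f trm" "'f trm"
  | Pred 'p "'f trm list"
  | Conn "real list \<Rightarrow> real" "('f, 'p) fm list"
  | QSup nat "('f, 'p) fm"
  | QInf nat "('f, 'p) fm"

definition is_connective :: "nat \<Rightarrow> (real list \<Rightarrow> real) \<Rightarrow> bool" where
  "is_connective n u \<longleftrightarrow>
     u ` tuples {0..1} n \<subseteq> {0..1} \<and>
     continuous_on ({..<n} \<rightarrow>\<^sub>E {0..1}) (\<lambda>x. u (map x [0..<n]))"

fun wf_trm :: "('f, 'p) signature \<Rightarrow> 'f trm \<Rightarrow> bool" where
  "wf_trm L (Var i) \<longleftrightarrow> True"
| "wf_trm L (App F ts) \<longleftrightarrow>
     F \<in> funs L \<and> length ts = fun_arity L F \<and> (\<forall>t\<in>set ts. wf_trm L t)"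

fun fv_trm :: "'f trm \<Rightarrow> nat set" where
  "fv_trm (Var i) = {i}"
| "fv_trm (App F ts) = (\<Union>t\<in>set ts. fv_trm t)"

fun wf_fm :: "('f, 'p) signature \<Rightarrow> ('f, 'p) fm \<Rightarrow> bool" where
  "wf_fm L (Dist s t) \<longleftrightarrow> wf_trm L s \<and> wf_trm L t"
| "wf_fm L (Pred P ts) \<longleftrightarrow>
     P \<in> preds L \<and> length ts = pred_arity L P \<and> (\<forall>t\<in>set ts. wf_trm L t)"
| "wf_fm L (Conn u \<phi>s) \<longleftrightarrow> is_connective (length \<phi>s) u \<and> (\<forall>\<phi>\<in>set \<phi>s. wf_fm L \<phi>)"
| "wf_fm L (QSup i \<phi>) \<longleftrightarrow> wf_fm L \<phi>"
| "wf_fm L (QInf i \<phi>) \<longleftrightarrow> wf_fm L \<phi>"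

fun fv :: "('f, 'p) fm \<Rightarrow> nat set" where
  "fv (Dist s t) = fv_trm s \<union> fv_trm t"
| "fv (Pred P ts) = (\<Union>t\<in>set ts. fv_trm t)"
| "fv (Conn u \<phi>s) = (\<Union>\<phi>\<in>set \<phi>s. fv \<phi>)"
| "fv (QSup i \<phi>) = fv \<phi> - {i}"
| "fv (QInf i \<phi>) = fv \<phi> - {i}"

fun quantifier_free :: "('f, 'p) fm \<Rightarrow> bool" where
  "quantifier_free (Dist s t) \<longleftrightarrow> True"
| "quantifier_free (Pred P ts) \<longleftrightarrow> True"
| "quantifier_free (Conn u \<phi>s) \<longleftrightarrow> (\<forall>\<phi>\<in>set \<phi>s. quantifier_free \<phi>)"
| "quantifier_free (QSup i \<phi>) \<longleftrightarrow> False"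
| "quantifier_free (QInf i \<phi>) \<longleftrightarrow> False"

definition sentences :: "('f, 'p) signature \<Rightarrow> ('f, 'p) fm set" where
  "sentences L = {\<sigma>. wf_fm L \<sigma> \<and> fv \<sigma> = {}}"

section \<open>Semantics\<close>

fun tval :: "('f, 'p, 'a) metric_structure \<Rightarrow> (nat \<Rightarrow> 'a) \<Rightarrow> 'f trm \<Rightarrow> 'a" where
  "tval M s (Var i) = s i"
| "tval M s (App F ts) = fun_interp M F (map (tval M s) ts)"

fun fval :: "('f, 'p, 'a) metric_structure \<Rightarrow> (nat \<Rightarrow> 'a) \<Rightarrow> ('f, 'p) fm \<Rightarrow> real" where
  "fval M s (Dist t t') = metric M (tval M s t) (tval M s t')"
| "fval M s (Pred P ts) = pred_interp M P (map (tval M s) ts)"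
| "fval M s (Conn u \<phi>s) = u (map (fval M s) \<phi>s)"
| "fval M s (QSup i \<phi>) = (SUP a\<in>points M. fval M (s(i := a)) \<phi>)"
| "fval M s (QInf i \<phi>) = (INF a\<in>points M. fval M (s(i := a)) \<phi>)"

section \<open>Theories\<close>

text \<open>The closed condition \<open>\<sigma> = 0\<close> is represented by the sentence \<open>\<sigma>\<close>.\<close>

definition is_theory :: "('f, 'p) signature \<Rightarrow> ('f, 'p) fm set \<Rightarrow> bool" where
  "is_theory L T \<longleftrightarrow> T \<subseteq> sentences L"

definition models :: "('f, 'p) signature \<Rightarrow> ('f, 'p, 'a) metric_structure \<Rightarrow> ('f, 'p) fm set \<Rightarrow> bool" where
  "models L M T \<longleftrightarrow>
     is_structure L M \<and> (\<forall>\<sigma>\<in>T. \<forall>s. range s \<subseteq> points M \<longrightarrow> fval M s \<sigma> = 0)"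

definition universal :: "('f, 'p) fm \<Rightarrow> bool" where
  "universal \<sigma> \<longleftrightarrow> (\<exists>xs \<phi>. quantifier_free \<phi> \<and> \<sigma> = foldr QSup xs \<phi>)"

definition existential :: "('f, 'p) fm \<Rightarrow> bool" where
  "existential \<sigma> \<longleftrightarrow> (\<exists>xs \<phi>. quantifier_free \<phi> \<and> \<sigma> = foldr QInf xs \<phi>)"

text \<open>The next two notions quantify over all models of a theory. HOL cannot quantify over
  types, so the models range over all structures whose points lie in a type \<open>'u\<close>.
  This is no restriction as soon as \<open>'u\<close> has at least
  \<open>(|funs L| + |preds L| + \<aleph>\<^sub>0)\<close> to the power \<open>\<aleph>\<^sub>0\<close> elements: by the downward Loewenheim-Skolem
  theorem every structure, of whatever size, has an elementary substructure of density
  character at most \<open>|funs L| + |preds L| + \<aleph>\<^sub>0\<close> (up to uniform approximation that many connectives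
  suffice), and this has an isomorphic copy with points in \<open>'u\<close>. Both notions depend only on which values
  formulas take in models, hence on models up to elementary equivalence.\<close>

definition axiomatizes ::
    "'u itself \<Rightarrow> ('f, 'p) signature \<Rightarrow> ('f, 'p) fm set \<Rightarrow> ('f, 'p) fm set \<Rightarrow> bool" where
  "axiomatizes _ L A T \<longleftrightarrow>
     (\<forall>N :: ('f, 'p, 'u) metric_structure. models L N A \<longleftrightarrow> models L N T)"

definition primitive :: "'u itself \<Rightarrow> ('f, 'p) signature \<Rightarrow> ('f, 'p) fm set \<Rightarrow> bool" where
  "primitive U L T \<longleftrightarrow>
     (\<exists>\<Gamma> \<Delta>. \<Gamma> \<subseteq> {\<sigma> \<in> sentences L. universal \<sigma>} \<and> \<Delta> \<subseteq> {\<sigma> \<in> sentences L. existential \<sigma>} \<and>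
            axiomatizes U L (\<Gamma> \<union> \<Delta>) T)"

definition admits_QE :: "'u itself \<Rightarrow> ('f, 'p) signature \<Rightarrow> ('f, 'p) fm set \<Rightarrow> bool" where
  "admits_QE _ L T \<longleftrightarrow>
     (\<forall>\<phi>. wf_fm L \<phi> \<longrightarrow> (\<forall>\<delta>>0. \<exists>\<psi>. wf_fm L \<psi> \<and> quantifier_free \<psi> \<and> fv \<psi> \<subseteq> fv \<phi> \<and>
        (\<forall>N :: ('f, 'p, 'u) metric_structure. models L N T \<longrightarrow>
           (\<forall>s. range s \<subseteq> points N \<longrightarrow> \<bar>fval N s \<phi> - fval N s \<psi>\<bar> \<le> \<delta>))))"

text \<open>A type of the required size. Including the type \<open>'m\<close> of the points of a given structure
  makes room for copies of that structure and of those generated by it and countably many new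
  points.\<close>

type_synonym ('f, 'p, 'm) universe = "nat \<Rightarrow> 'f + 'p + 'm + nat"

section \<open>Parameters and definable functions\<close>

text \<open>\<open>\<L>(M)\<close> and the expansion of \<open>M\<close> to it. The modulus of a constant is irrelevant.\<close>

definition sig_consts :: "('f, 'p) signature \<Rightarrow> 'm set \<Rightarrow> ('f + 'm, 'p) signature" where
  "sig_consts L A =
     \<lparr>funs = Inl ` funs L \<union> Inr ` A,
      preds = preds L,
      fun_arity = case_sum (fun_arity L) (\<lambda>_. 0),
      pred_arity = pred_arity L,
      fun_modulus = case_sum (fun_modulus L) (\<lambda>_ _. 1),
      pred_modulus = pred_modulus L\<rparr>"

definition struct_consts :: "('f, 'p, 'm) metric_structure \<Rightarrow> ('f + 'm, 'p, 'm) metric_structure" where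
  "struct_consts M =
     \<lparr>points = points M,
      metric = metric M,
      fun_interp = case_sum (fun_interp M) (\<lambda>c _. c),
      pred_interp = pred_interp M\<rparr>"

text \<open>In \<open>(!) as\<close>, a list \<open>as\<close> of length \<open>k\<close> is used as an assignment; only its values at the
  variables \<open>0, \<dots>, k - 1\<close> matter.\<close>

definition definable_predicate ::
    "('f, 'p) signature \<Rightarrow> ('f, 'p, 'm) metric_structure \<Rightarrow> nat \<Rightarrow> ('m list \<Rightarrow> real) \<Rightarrow> bool" where
  "definable_predicate L M k P \<longleftrightarrow>
     (\<exists>\<phi> :: nat \<Rightarrow> ('f + 'm, 'p) fm.
        (\<forall>j. wf_fm (sig_consts L (points M)) (\<phi> j) \<and> fv (\<phi> j) \<subseteq> {..<k}) \<and>
        uniform_limit (tuples (points M) k) (\<lambda>j as. fval (struct_consts M) ((!) as) (\<phi> j)) P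
          sequentially)"

definition definable_function ::
    "('f, 'p) signature \<Rightarrow> ('f, 'p, 'm) metric_structure \<Rightarrow> nat \<Rightarrow> ('m list \<Rightarrow> 'm) \<Rightarrow> bool" where
  "definable_function L M n f \<longleftrightarrow>
     f ` tuples (points M) n \<subseteq> points M \<and>
     definable_predicate L M (Suc n) (\<lambda>as. metric M (f (take n as)) (as ! n))"

end

theory Submission
  imports Defs
begin

text \<open>Suppose that no finite set of \<open>L(M)\<close>-terms works for \<open>\<epsilon>\<close>. For each term \<open>t\<close> consider the set of all
  tuples \<open>a\<close> with \<open>d(f(a), t(a)) > \<epsilon>\<close>. By assumption these sets have the finite intersection property,
  so they generate a proper filter on \<open>M\<^sup>n\<close>. By Tychonoff's theorem there is a finer proper filter \<open>G\<close> along
  which the value of every atomic formula in \<open>L(M)\<close>-terms converges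
  (\<open>convergent_subfilter\<close>, \<open>term_limit_subfilter\<close>). The limits turn the set of terms into a prestructure. Its completion \<open>N\<close>
  (\<open>is_structure_completion\<close>) is the structure generated by \<open>M\<close> and a generic tuple, and in it the terms
  are dense. No elementary extension of \<open>M\<close> is involved: only values of
  quantifier-free formulas are passed between \<open>M\<close> and \<open>N\<close>, and these are limits along \<open>G\<close> by continuity of the connectives
  (\<open>fval_TS_lim\<close>, \<open>fval_completion_lim\<close>).

  The structure \<open>N\<close> is a model of \<open>T\<close>: universal conditions that hold in \<open>M\<close> hold in \<open>N\<close> because they say that
  a quantifier-free formula vanishes, and existential ones hold in \<open>N\<close> because \<open>M\<close> embeds into it
  (\<open>models_completion\<close>). As \<open>T\<close> is primitive, this is enough.

  Now let the formula \<open>\<phi>(x, y)\<close> approximate \<open>d(f(x), y)\<close> on \<open>M\<close>. Then \<open>inf\<^sub>y \<phi>(a, y)\<close> is close to 0 for all \<open>a\<close>. By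
  quantifier elimination, applied in \<open>M\<close> and in \<open>N\<close>, it is also close to 0 at the generic tuple of \<open>N\<close>, where
  the infimum is nearly attained at some term \<open>t\<close>. By quantifier elimination for \<open>\<phi>\<close> itself, \<open>\<phi>(a, t(a))\<close> is
  close to 0 for \<open>G\<close>-almost all \<open>a\<close> (\<open>eventually_witness_term\<close>). For these, \<open>d(f(a), t(a)) < \<epsilon>\<close>, which contradicts
  the choice of the filter.

  The hypotheses on \<open>T\<close> speak of models in a fixed universe and of formulas without
  parameters. The points of \<open>N\<close> are sequences of terms, so both \<open>M\<close> and \<open>N\<close> have copies in the universe
  (\<open>models_transport_iff\<close>), and parameters can be traded for variables (\<open>parameters_as_variables\<close>).\<close>

section \<open>Limits along filters\<close>

lemma tendsto_product_iff:
  fixes f :: "'a \<Rightarrow> 'i \<Rightarrow> real"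
  shows "(f \<longlongrightarrow> l) F \<longleftrightarrow> (\<forall>i. ((\<lambda>x. f x i) \<longlongrightarrow> l i) F)"
proof -
  have "(f \<longlongrightarrow> l) F \<longleftrightarrow> limitin (product_topology (\<lambda>i. euclideanreal) UNIV) f l F"
    by (simp add: euclidean_product_topology)
  also have "\<dots> \<longleftrightarrow> (\<forall>i. ((\<lambda>x. f x i) \<longlongrightarrow> l i) F)"
    by (simp add: limitin_componentwise)
  finally show ?thesis .
qed

lemma compact_unit_cube: "compact (UNIV \<rightarrow>\<^sub>E {0..1::real} :: ('i \<Rightarrow> real) set)"
proof -
  have "compactin (product_topology (\<lambda>i::'i. euclideanreal) UNIV) (UNIV \<rightarrow>\<^sub>E {0..1})"
    by (simp add: compactin_PiE)
  then show ?thesis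
    by (simp add: euclidean_product_topology)
qed

text \<open>Compactness of the cube \<open>[0,1]\<^sup>I\<close> takes the place of an ultrafilter: a cluster point of the
  image filter supplies all the limits at once, and the preimages of its neighbourhoods refine
  the given filter.\<close>

lemma convergent_subfilter:
  fixes g :: "'i \<Rightarrow> 'a \<Rightarrow> real"
  assumes "F \<noteq> bot" and bounded: "\<forall>\<^sub>F x in F. \<forall>i\<in>I. g i x \<in> {0..1}"
  obtains G where "G \<le> F" "G \<noteq> bot" "\<And>i. i \<in> I \<Longrightarrow> \<exists>l. (g i \<longlongrightarrow> l) G"
proof -
  define h where "h x = (\<lambda>i. if i \<in> I then g i x else 0)" for x
  have "filtermap h F \<noteq> bot"
    using assms(1) by (simp add: filtermap_bot_iff)
  moreover have "\<forall>\<^sub>F p in filtermap h F. p \<in> UNIV \<rightarrow>\<^sub>E {0..1}"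
    unfolding eventually_filtermap by (rule eventually_mono[OF bounded]) (auto simp: h_def)
  ultimately obtain p where p: "inf (nhds p) (filtermap h F) \<noteq> bot"
    using compact_unit_cube unfolding compact_filter by blast
  define G where "G = inf F (filtercomap h (nhds p))"
  have "G \<noteq> bot"
  proof
    assume "G = bot"
    then have "eventually (\<lambda>_. False) G"
      by simp
    then obtain A B where "eventually A F" "eventually B (nhds p)" and AB: "\<And>x. A x \<Longrightarrow> \<not> B (h x)"
      unfolding G_def eventually_inf eventually_filtercomap by blast
    then have "eventually (\<lambda>q. \<not> B q) (filtermap h F)"
      unfolding eventually_filtermap by (auto elim: eventually_mono)
    with \<open>eventually B (nhds p)\<close> have "eventually (\<lambda>_. False) (inf (nhds p) (filtermap h F))"
      unfolding eventually_inf by blast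
    with p show False
      by (simp add: trivial_limit_def)
  qed
  moreover have "(h \<longlongrightarrow> p) G"
    unfolding filterlim_iff_le_filtercomap G_def by simp
  then have lim: "((\<lambda>x. h x i) \<longlongrightarrow> p i) G" for i
    by (simp add: tendsto_product_iff)
  have "\<exists>l. (g i \<longlongrightarrow> l) G" if "i \<in> I" for i
    using that lim[of i] unfolding h_def by auto
  moreover have "G \<le> F"
    by (simp add: G_def)
  ultimately show thesis
    using that by blast
qed

text \<open>Connectives are continuous on a cube of functions, whereas formulas apply them to lists;
  this is the continuity in the form that the evaluation of formulas needs.\<close>

lemma is_connective_tendsto:
  assumes u: "is_connective n u"
    and xs: "\<forall>\<^sub>F i in F. xs i \<in> tuples {0..1} n" and ys: "ys \<in> tuples {0..1} n"
    and lim: "\<And>j. j < n \<Longrightarrow> ((\<lambda>i. xs i ! j) \<longlongrightarrow> ys ! j) F"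
  shows "((\<lambda>i. u (xs i)) \<longlongrightarrow> u ys) F"
proof -
  define r :: "real list \<Rightarrow> nat \<Rightarrow> real" where "r zs = restrict ((!) zs) {..<n}" for zs
  have r: "r zs \<in> {..<n} \<rightarrow>\<^sub>E {0..1}" "map (r zs) [0..<n] = zs" if "zs \<in> tuples {0..1} n" for zs
    using that by (auto simp: r_def tuples_def subset_iff in_set_conv_nth intro!: nth_equalityI)
  have "((\<lambda>i. r (xs i)) \<longlongrightarrow> r ys) F"
    unfolding tendsto_product_iff using lim by (auto simp: r_def)
  then have "((\<lambda>i. u (map (r (xs i)) [0..<n])) \<longlongrightarrow> u (map (r ys) [0..<n])) F"
    using u r(1)[OF ys] eventually_mono[OF xs r(1)] unfolding is_connective_def
    by (intro continuous_on_tendsto_compose[where f = "\<lambda>x. u (map x [0..<n])"]) simp_all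
  then show ?thesis
    unfolding r(2)[OF ys]
  proof (rule Lim_transform_eventually)
    show "\<forall>\<^sub>F i in F. u (map (r (xs i)) [0..<n]) = u (xs i)"
      using xs by eventually_elim (simp add: r(2))
  qed
qed

lemma convergent_if_differences_vanish:
  fixes f :: "nat \<Rightarrow> real"
  assumes "((\<lambda>(a, b). f a - f b) \<longlongrightarrow> 0) (sequentially \<times>\<^sub>F sequentially)"
  shows "convergent f"
proof (rule Cauchy_convergent, rule metric_CauchyI)
  fix e :: real
  assume "0 < e"
  with assms have "\<forall>\<^sub>F p in sequentially \<times>\<^sub>F sequentially. dist (case p of (a, b) \<Rightarrow> f a - f b) 0 < e"
    by (rule tendstoD)
  then show "\<exists>K. \<forall>m\<ge>K. \<forall>n\<ge>K. dist (f m) (f n) < e"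
    by (auto simp: eventually_prod_sequentially dist_real_def)
qed

lemma tendsto_0_if_le_add:
  fixes f g h :: "'a \<Rightarrow> real"
  assumes "\<forall>\<^sub>F x in F. \<bar>f x\<bar> \<le> g x + h x" "(g \<longlongrightarrow> 0) F" "(h \<longlongrightarrow> 0) F"
  shows "(f \<longlongrightarrow> 0) F"
proof (rule tendsto_0_le[where K = 1])
  show "((\<lambda>x. g x + h x) \<longlongrightarrow> 0) F"
    using tendsto_add[OF assms(2,3)] by simp
  show "\<forall>\<^sub>F x in F. norm (f x) \<le> norm (g x + h x) * 1"
    using assms(1) by eventually_elim simp
qed

section \<open>Prestructures\<close>

text \<open>A prestructure is what remains of a structure when distinct points may have distance 0 and
  limits of Cauchy sequences may be missing. Sets of terms, with values taken as limits of their
  values in a structure, are of this kind.\<close>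

locale prestructure =
  fixes L :: "('f, 'p) signature" and N :: "('f, 'p, 'a) metric_structure"
  assumes signature: "is_signature L"
    and nonempty: "points N \<noteq> {}"
    and metric_self: "x \<in> points N \<Longrightarrow> metric N x x = 0"
    and metric_sym: "x \<in> points N \<Longrightarrow> y \<in> points N \<Longrightarrow> metric N x y = metric N y x"
    and metric_triangle:
      "x \<in> points N \<Longrightarrow> y \<in> points N \<Longrightarrow> z \<in> points N \<Longrightarrow> metric N x z \<le> metric N x y + metric N y z"
    and metric_le_1: "x \<in> points N \<Longrightarrow> y \<in> points N \<Longrightarrow> metric N x y \<le> 1"
    and fun_closed:
      "F \<in> funs L \<Longrightarrow> xs \<in> tuples (points N) (fun_arity L F) \<Longrightarrow> fun_interp N F xs \<in> points N"
    and fun_ucont: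
      "F \<in> funs L \<Longrightarrow> xs \<in> tuples (points N) (fun_arity L F) \<Longrightarrow> ys \<in> tuples (points N) (fun_arity L F)
        \<Longrightarrow> \<epsilon> \<in> {0<..1} \<Longrightarrow> \<forall>i<fun_arity L F. metric N (xs ! i) (ys ! i) < fun_modulus L F \<epsilon>
        \<Longrightarrow> metric N (fun_interp N F xs) (fun_interp N F ys) \<le> \<epsilon>"
    and pred_unit:
      "P \<in> preds L \<Longrightarrow> xs \<in> tuples (points N) (pred_arity L P) \<Longrightarrow> pred_interp N P xs \<in> {0..1}"
    and pred_ucont:
      "P \<in> preds L \<Longrightarrow> xs \<in> tuples (points N) (pred_arity L P) \<Longrightarrow> ys \<in> tuples (points N) (pred_arity L P)
        \<Longrightarrow> \<epsilon> \<in> {0<..1} \<Longrightarrow> \<forall>i<pred_arity L P. metric N (xs ! i) (ys ! i) < pred_modulus L P \<epsilon>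
        \<Longrightarrow> \<bar>pred_interp N P xs - pred_interp N P ys\<bar> \<le> \<epsilon>"

lemma is_structure_iff_prestructure:
  assumes "is_signature L"
  shows "is_structure L N \<longleftrightarrow>
    prestructure L N \<and> Metric_space (points N) (metric N) \<and> Metric_space.mcomplete (points N) (metric N)"
proof
  assume N: "is_structure L N"
  interpret Metric_space "points N" "metric N"
    using N by (simp add: is_structure_def)
  have "prestructure L N"
    using N assms commute triangle by (unfold_locales) (auto simp: is_structure_def)
  then show "prestructure L N \<and> Metric_space (points N) (metric N) \<and> Metric_space.mcomplete (points N) (metric N)"
    using N by (simp add: is_structure_def)
next
  assume N: "prestructure L N \<and> Metric_space (points N) (metric N) \<and> Metric_space.mcomplete (points N) (metric N)"
  then interpret prestructure L N
    by simp
  show "is_structure L N"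
    unfolding is_structure_def
    by (intro conjI ballI impI) (simp_all add: N nonempty metric_le_1 fun_closed fun_ucont pred_unit[simplified] pred_ucont)
qed

lemma tuples_nth: "xs \<in> tuples A n \<Longrightarrow> i < n \<Longrightarrow> xs ! i \<in> A"
  by (auto simp: tuples_def)

lemma map_in_tuples: "length xs = n \<Longrightarrow> (\<And>x. x \<in> set xs \<Longrightarrow> f x \<in> A) \<Longrightarrow> map f xs \<in> tuples A n"
  by (auto simp: tuples_def)

context prestructure
begin

lemma metric_nonneg: "x \<in> points N \<Longrightarrow> y \<in> points N \<Longrightarrow> 0 \<le> metric N x y"
  using metric_triangle[of x y x] metric_self[of x] metric_sym[of x y] by simp

lemma metric_quadrangle:
  assumes "x \<in> points N" "y \<in> points N" "x' \<in> points N" "y' \<in> points N"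
  shows "\<bar>metric N x y - metric N x' y'\<bar> \<le> metric N x x' + metric N y y'"
proof -
  have "metric N x y \<le> metric N x x' + (metric N x' y' + metric N y' y)"
    using assms metric_triangle[of x x' y] metric_triangle[of x' y' y] by simp
  moreover have "metric N x' y' \<le> metric N x' x + (metric N x y + metric N y y')"
    using assms metric_triangle[of x' x y'] metric_triangle[of x y y'] by simp
  ultimately show ?thesis
    using assms metric_sym[of x x'] metric_sym[of y y'] by (simp add: abs_le_iff)
qed

lemma tval_in_points:
  "wf_trm L t \<Longrightarrow> (\<And>v. v \<in> fv_trm t \<Longrightarrow> s v \<in> points N) \<Longrightarrow> tval N s t \<in> points N"
  by (induction t) (auto intro!: fun_closed map_in_tuples)

lemma fval_unit:
  "wf_fm L \<phi> \<Longrightarrow> range s \<subseteq> points N \<Longrightarrow> fval N s \<phi> \<in> {0..1}"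
proof (induction \<phi> arbitrary: s)
  case (Dist t t')
  then show ?case
    using tval_in_points[of t s] tval_in_points[of t' s] metric_nonneg metric_le_1
    by (auto simp: subset_iff)
next
  case (Pred P ts)
  then have "map (tval N s) ts \<in> tuples (points N) (pred_arity L P)"
    by (auto intro!: map_in_tuples tval_in_points)
  with Pred show ?case
    using pred_unit by simp
next
  case (Conn u \<phi>s)
  then have "map (fval N s) \<phi>s \<in> tuples {0..1} (length \<phi>s)"
    by (intro map_in_tuples) auto
  with Conn.prems show ?case
    by (auto simp: is_connective_def)
next
  case (QSup i \<phi>)
  have *: "fval N (s(i := a)) \<phi> \<in> {0..1}" if "a \<in> points N" for a
    using QSup that by (intro QSup.IH) auto
  from nonempty obtain a where "a \<in> points N"
    by blast
  with * have "fval N (s(i := a)) \<phi> \<le> (SUP a\<in>points N. fval N (s(i := a)) \<phi>)"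
    by (intro cSUP_upper bdd_aboveI2[where M = 1]) auto
  with * \<open>a \<in> points N\<close> nonempty show ?case
    by (auto intro!: cSUP_least intro: order_trans)
next
  case (QInf i \<phi>)
  have *: "fval N (s(i := a)) \<phi> \<in> {0..1}" if "a \<in> points N" for a
    using QInf that by (intro QInf.IH) auto
  from nonempty obtain a where "a \<in> points N"
    by blast
  with * have "(INF a\<in>points N. fval N (s(i := a)) \<phi>) \<le> fval N (s(i := a)) \<phi>"
    by (intro cINF_lower bdd_belowI2[where m = 0]) auto
  with * \<open>a \<in> points N\<close> nonempty show ?case
    by (auto intro!: cINF_greatest intro: order_trans)
qed

text \<open>The suprema and infima that interpret quantifiers are those of bounded sets because formulas
  take values in \<open>[0,1]\<close>; otherwise the following comparisons would fail.\<close>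

lemma fval_instance_le_sup:
  assumes "wf_fm L \<phi>" "range s \<subseteq> points N" "a \<in> points N"
  shows "fval N (s(i := a)) \<phi> \<le> fval N s (QSup i \<phi>)"
proof -
  have "fval N (s(i := b)) \<phi> \<in> {0..1}" if "b \<in> points N" for b
    using assms that by (intro fval_unit) auto
  then show ?thesis
    unfolding fval.simps using assms by (intro cSUP_upper bdd_aboveI2[where M = 1]) auto
qed

lemma fval_inf_le_instance:
  assumes "wf_fm L \<phi>" "range s \<subseteq> points N" "a \<in> points N"
  shows "fval N s (QInf i \<phi>) \<le> fval N (s(i := a)) \<phi>"
proof -
  have "fval N (s(i := b)) \<phi> \<in> {0..1}" if "b \<in> points N" for b
    using assms that by (intro fval_unit) auto
  then show ?thesis
    unfolding fval.simps using assms by (intro cINF_lower bdd_belowI2[where m = 0]) auto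
qed

text \<open>The filter \<open>G\<close> is general here and in the next lemma: it ranges over single
  indices when equivalent sequences are compared, and over pairs of indices when a sequence is
  shown to be Cauchy.\<close>

lemma fun_tendsto:
  assumes F: "F \<in> funs L"
    and xs: "\<forall>\<^sub>F i in G. xs i \<in> tuples (points N) (fun_arity L F)"
    and ys: "\<forall>\<^sub>F i in G. ys i \<in> tuples (points N) (fun_arity L F)"
    and lim: "\<And>j. j < fun_arity L F \<Longrightarrow> ((\<lambda>i. metric N (xs i ! j) (ys i ! j)) \<longlongrightarrow> 0) G"
  shows "((\<lambda>i. metric N (fun_interp N F (xs i)) (fun_interp N F (ys i))) \<longlongrightarrow> 0) G"
proof (rule tendstoI)
  fix e :: real
  assume "0 < e"
  define \<epsilon> where "\<epsilon> = min (e / 2) 1"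
  have \<epsilon>: "\<epsilon> \<in> {0<..1}" "\<epsilon> < e"
    using \<open>0 < e\<close> by (auto simp: \<epsilon>_def)
  have "0 < fun_modulus L F \<epsilon>"
    using F \<epsilon> signature by (auto simp: is_signature_def is_modulus_def)
  then have "\<forall>\<^sub>F i in G. \<forall>j\<in>{..<fun_arity L F}. metric N (xs i ! j) (ys i ! j) < fun_modulus L F \<epsilon>"
    by (intro eventually_ball_finite ballI order_tendstoD(2)[OF lim]) auto
  with xs ys show "\<forall>\<^sub>F i in G. dist (metric N (fun_interp N F (xs i)) (fun_interp N F (ys i))) 0 < e"
  proof eventually_elim
    case (elim i)
    then have "metric N (fun_interp N F (xs i)) (fun_interp N F (ys i)) \<le> \<epsilon>"
      using F \<epsilon> by (intro fun_ucont) auto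
    moreover have "0 \<le> metric N (fun_interp N F (xs i)) (fun_interp N F (ys i))"
      using F elim by (intro metric_nonneg fun_closed)
    ultimately show ?case
      using \<epsilon> by simp
  qed
qed

lemma pred_tendsto:
  assumes P: "P \<in> preds L"
    and xs: "\<forall>\<^sub>F i in G. xs i \<in> tuples (points N) (pred_arity L P)"
    and ys: "\<forall>\<^sub>F i in G. ys i \<in> tuples (points N) (pred_arity L P)"
    and lim: "\<And>j. j < pred_arity L P \<Longrightarrow> ((\<lambda>i. metric N (xs i ! j) (ys i ! j)) \<longlongrightarrow> 0) G"
  shows "((\<lambda>i. pred_interp N P (xs i) - pred_interp N P (ys i)) \<longlongrightarrow> 0) G"
proof (rule tendstoI)
  fix e :: real
  assume "0 < e"
  define \<epsilon> where "\<epsilon> = min (e / 2) 1"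
  have \<epsilon>: "\<epsilon> \<in> {0<..1}" "\<epsilon> < e"
    using \<open>0 < e\<close> by (auto simp: \<epsilon>_def)
  have "0 < pred_modulus L P \<epsilon>"
    using P \<epsilon> signature by (auto simp: is_signature_def is_modulus_def)
  then have "\<forall>\<^sub>F i in G. \<forall>j\<in>{..<pred_arity L P}. metric N (xs i ! j) (ys i ! j) < pred_modulus L P \<epsilon>"
    by (intro eventually_ball_finite ballI order_tendstoD(2)[OF lim]) auto
  with xs ys show "\<forall>\<^sub>F i in G. dist (pred_interp N P (xs i) - pred_interp N P (ys i)) 0 < e"
  proof eventually_elim
    case (elim i)
    then have "\<bar>pred_interp N P (xs i) - pred_interp N P (ys i)\<bar> \<le> \<epsilon>"
      using P \<epsilon> by (intro pred_ucont) auto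
    then show ?case
      using \<epsilon> by simp
  qed
qed

end

lemma tval_cong: "(\<And>v. v \<in> fv_trm t \<Longrightarrow> s v = s' v) \<Longrightarrow> tval N s t = tval N s' t"
proof (induction t)
  case (App F ts)
  then have "map (tval N s) ts = map (tval N s') ts"
    by auto
  then show ?case
    by (simp only: tval.simps)
qed simp

lemma fval_cong: "(\<And>v. v \<in> fv \<phi> \<Longrightarrow> s v = s' v) \<Longrightarrow> fval N s \<phi> = fval N s' \<phi>"
proof (induction \<phi> arbitrary: s s')
  case (Dist t t')
  then show ?case
    using tval_cong[of t s s' N] tval_cong[of t' s s' N] by simp
next
  case (Pred P ts)
  then have "map (tval N s) ts = map (tval N s') ts"
    by (auto intro!: tval_cong)
  then show ?case
    by (simp only: fval.simps)
next
  case (Conn u \<phi>s)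
  then have "map (fval N s) \<phi>s = map (fval N s') \<phi>s"
    by (intro map_cong refl Conn.IH Conn.prems) auto
  then show ?case
    by (simp only: fval.simps)
next
  case (QSup i \<phi>)
  then have "fval N (s(i := a)) \<phi> = fval N (s'(i := a)) \<phi>" for a
    by (intro QSup.IH) auto
  then show ?case
    by simp
next
  case (QInf i \<phi>)
  then have "fval N (s(i := a)) \<phi> = fval N (s'(i := a)) \<phi>" for a
    by (intro QInf.IH) auto
  then show ?case
    by simp
qed

text \<open>Convergence of the atomic formulas suffices, because connectives are continuous. The index
  set and the two structures are kept apart so that the lemma covers both passages below: from a
  structure to the terms over it, along a filter of tuples, and from a prestructure to its
  completion, along Cauchy sequences.\<close>

lemma quantifier_free_fval_tendsto:
  assumes A: "prestructure L A" and B: "prestructure L B"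
    and \<sigma>: "\<forall>\<^sub>F i in G. range (\<sigma> i) \<subseteq> points A" and \<tau>: "range \<tau> \<subseteq> points B"
    and Dist: "\<And>t t'. wf_trm L t \<Longrightarrow> wf_trm L t' \<Longrightarrow>
      ((\<lambda>i. fval A (\<sigma> i) (Dist t t')) \<longlongrightarrow> fval B \<tau> (Dist t t')) G"
    and Pred: "\<And>P ts. wf_fm L (Pred P ts) \<Longrightarrow>
      ((\<lambda>i. fval A (\<sigma> i) (Pred P ts)) \<longlongrightarrow> fval B \<tau> (Pred P ts)) G"
  shows "wf_fm L \<phi> \<Longrightarrow> quantifier_free \<phi> \<Longrightarrow> ((\<lambda>i. fval A (\<sigma> i) \<phi>) \<longlongrightarrow> fval B \<tau> \<phi>) G"
proof (induction \<phi>)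
  case (Dist t t')
  then show ?case
    using assms(5) by simp
next
  case (Pred P ts)
  then show ?case
    using assms(6) by simp
next
  case (Conn u \<phi>s)
  show ?case
    unfolding fval.simps
  proof (rule is_connective_tendsto)
    show "is_connective (length \<phi>s) u"
      using Conn.prems by simp
    show "\<forall>\<^sub>F i in G. map (fval A (\<sigma> i)) \<phi>s \<in> tuples {0..1} (length \<phi>s)"
      using \<sigma> by eventually_elim (use Conn.prems prestructure.fval_unit[OF A] in \<open>auto intro!: map_in_tuples\<close>)
    show "map (fval B \<tau>) \<phi>s \<in> tuples {0..1} (length \<phi>s)"
      using Conn.prems prestructure.fval_unit[OF B _ \<tau>] by (auto intro!: map_in_tuples)
    show "((\<lambda>i. map (fval A (\<sigma> i)) \<phi>s ! j) \<longlongrightarrow> map (fval B \<tau>) \<phi>s ! j) G" if "j < length \<phi>s" for j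
      using that Conn by simp
  qed
qed simp_all

section \<open>Completion of a prestructure\<close>

definition cauchy_seqs :: "('f, 'p, 'a) metric_structure \<Rightarrow> (nat \<Rightarrow> 'a) set" where
  "cauchy_seqs N = {s. range s \<subseteq> points N \<and>
     ((\<lambda>(a, b). metric N (s a) (s b)) \<longlongrightarrow> 0) (sequentially \<times>\<^sub>F sequentially)}"

definition same_limit :: "('f, 'p, 'a) metric_structure \<Rightarrow> (nat \<Rightarrow> 'a) \<Rightarrow> (nat \<Rightarrow> 'a) \<Rightarrow> bool" where
  "same_limit N s t \<longleftrightarrow> (\<lambda>k. metric N (s k) (t k)) \<longlonglongrightarrow> 0"

text \<open>The choice depends only on the predicate \<open>\<lambda>t. t \<in> cauchy_seqs N \<and> same_limit N s t\<close>, which equivalent Cauchy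
  sequences share. Every class thus has one canonical representative, and
  the points of the completion are again sequences of points of \<open>N\<close>.\<close>

definition limit_point :: "('f, 'p, 'a) metric_structure \<Rightarrow> (nat \<Rightarrow> 'a) \<Rightarrow> (nat \<Rightarrow> 'a)" where
  "limit_point N s = (SOME t. t \<in> cauchy_seqs N \<and> same_limit N s t)"

definition completion :: "('f, 'p, 'a) metric_structure \<Rightarrow> ('f, 'p, nat \<Rightarrow> 'a) metric_structure" where
  "completion N =
     \<lparr>points = limit_point N ` cauchy_seqs N,
      \<comment> \<open>The locale \<open>Metric_space\<close> demands symmetry and \<open>0 \<le> d p q\<close> off the carrier as well, where
        the limit may not exist; hence the default value 0.\<close>
      metric = \<lambda>p q. if p \<in> cauchy_seqs N \<and> q \<in> cauchy_seqs N then lim (\<lambda>k. metric N (p k) (q k)) else 0,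
      fun_interp = \<lambda>F ps. limit_point N (\<lambda>k. fun_interp N F (map (\<lambda>p. p k) ps)),
      pred_interp = \<lambda>P ps. lim (\<lambda>k. pred_interp N P (map (\<lambda>p. p k) ps))\<rparr>"

context prestructure
begin

lemma cauchy_seqsD: "s \<in> cauchy_seqs N \<Longrightarrow> s k \<in> points N"
  by (auto simp: cauchy_seqs_def)

lemma const_cauchy_seq: "x \<in> points N \<Longrightarrow> (\<lambda>_. x) \<in> cauchy_seqs N"
  by (simp add: cauchy_seqs_def metric_self case_prod_unfold)

lemma cauchy_seq_eventually_close:
  assumes "s \<in> cauchy_seqs N" "0 < e"
  obtains K where "\<And>a b. K \<le> a \<Longrightarrow> K \<le> b \<Longrightarrow> metric N (s a) (s b) < e"
proof -
  have "\<forall>\<^sub>F p in sequentially \<times>\<^sub>F sequentially. (case p of (a, b) \<Rightarrow> metric N (s a) (s b)) < e"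
    using assms by (intro order_tendstoD(2)[where y = 0]) (auto simp: cauchy_seqs_def)
  then show thesis
    using that by (auto simp: eventually_prod_sequentially)
qed

lemma metric_seq_convergent:
  assumes "s \<in> cauchy_seqs N" "t \<in> cauchy_seqs N"
  shows "convergent (\<lambda>k. metric N (s k) (t k))"
proof (rule convergent_if_differences_vanish, rule tendsto_0_if_le_add)
  show "((\<lambda>(a, b). metric N (s a) (s b)) \<longlongrightarrow> 0) (sequentially \<times>\<^sub>F sequentially)"
    "((\<lambda>(a, b). metric N (t a) (t b)) \<longlongrightarrow> 0) (sequentially \<times>\<^sub>F sequentially)"
    using assms by (auto simp: cauchy_seqs_def)
  show "\<forall>\<^sub>F p in sequentially \<times>\<^sub>F sequentially.
      \<bar>case p of (a, b) \<Rightarrow> metric N (s a) (t a) - metric N (s b) (t b)\<bar>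
      \<le> (case p of (a, b) \<Rightarrow> metric N (s a) (s b)) + (case p of (a, b) \<Rightarrow> metric N (t a) (t b))"
    using assms by (intro always_eventually) (auto intro!: metric_quadrangle cauchy_seqsD)
qed

lemma same_limit_refl: "s \<in> cauchy_seqs N \<Longrightarrow> same_limit N s s"
  by (simp add: same_limit_def metric_self cauchy_seqsD)

lemma same_limit_sym:
  "s \<in> cauchy_seqs N \<Longrightarrow> t \<in> cauchy_seqs N \<Longrightarrow> same_limit N s t \<Longrightarrow> same_limit N t s"
  by (simp add: same_limit_def metric_sym cauchy_seqsD)

lemma same_limit_trans:
  assumes "s \<in> cauchy_seqs N" "t \<in> cauchy_seqs N" "u \<in> cauchy_seqs N" "same_limit N s t" "same_limit N t u"
  shows "same_limit N s u"
  unfolding same_limit_def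
proof (rule tendsto_0_if_le_add)
  show "(\<lambda>k. metric N (s k) (t k)) \<longlonglongrightarrow> 0" "(\<lambda>k. metric N (t k) (u k)) \<longlonglongrightarrow> 0"
    using assms by (simp_all add: same_limit_def)
  show "\<forall>\<^sub>F k in sequentially. \<bar>metric N (s k) (u k)\<bar> \<le> metric N (s k) (t k) + metric N (t k) (u k)"
    using assms by (intro always_eventually allI)
      (simp add: metric_nonneg metric_triangle cauchy_seqsD)
qed

lemma limit_point:
  assumes "s \<in> cauchy_seqs N"
  shows "limit_point N s \<in> cauchy_seqs N" "same_limit N s (limit_point N s)"
  using someI[of "\<lambda>t. t \<in> cauchy_seqs N \<and> same_limit N s t" s] assms same_limit_refl
  by (auto simp: limit_point_def)

lemma limit_point_eqI:
  assumes "s \<in> cauchy_seqs N" "t \<in> cauchy_seqs N" "same_limit N s t"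
  shows "limit_point N s = limit_point N t"
proof -
  have "same_limit N s u \<longleftrightarrow> same_limit N t u" if "u \<in> cauchy_seqs N" for u
    using that assms same_limit_trans same_limit_sym by blast
  then have "(\<lambda>u. u \<in> cauchy_seqs N \<and> same_limit N s u) = (\<lambda>u. u \<in> cauchy_seqs N \<and> same_limit N t u)"
    by auto
  then show ?thesis
    unfolding limit_point_def by simp
qed

text \<open>A point of the completion is the canonical Cauchy sequence of its own class. It can therefore be
  used directly as a sequence of approximations in \<open>N\<close>.\<close>

lemma points_completion:
  "p \<in> points (completion N) \<longleftrightarrow> p \<in> cauchy_seqs N \<and> limit_point N p = p"
proof
  assume "p \<in> points (completion N)"
  then obtain s where s: "s \<in> cauchy_seqs N" "p = limit_point N s"
    by (auto simp: completion_def)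
  then show "p \<in> cauchy_seqs N \<and> limit_point N p = p"
    using limit_point limit_point_eqI by metis
next
  assume "p \<in> cauchy_seqs N \<and> limit_point N p = p"
  then have "p = limit_point N p" "p \<in> cauchy_seqs N"
    by simp_all
  then have "p \<in> limit_point N ` cauchy_seqs N"
    by (rule image_eqI)
  then show "p \<in> points (completion N)"
    by (simp add: completion_def)
qed

lemma limit_point_in_completion: "s \<in> cauchy_seqs N \<Longrightarrow> limit_point N s \<in> points (completion N)"
  by (simp add: completion_def)

lemma metric_completion_lim:
  assumes "p \<in> cauchy_seqs N" "q \<in> cauchy_seqs N"
  shows "(\<lambda>k. metric N (p k) (q k)) \<longlonglongrightarrow> metric (completion N) p q"
proof -
  have "metric (completion N) p q = lim (\<lambda>k. metric N (p k) (q k))"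
    using assms by (simp add: completion_def)
  then show ?thesis
    using metric_seq_convergent[OF assms] unfolding convergent_LIMSEQ_iff by (simp only:)
qed

lemma metric_limit_point_lim:
  assumes s: "s \<in> cauchy_seqs N" and t: "t \<in> cauchy_seqs N"
  shows "(\<lambda>k. metric N (s k) (t k)) \<longlonglongrightarrow> metric (completion N) (limit_point N s) (limit_point N t)"
proof -
  have "(\<lambda>k. metric N (s k) (t k) - metric N (limit_point N s k) (limit_point N t k)) \<longlonglongrightarrow> 0"
  proof (rule tendsto_0_if_le_add)
    show "(\<lambda>k. metric N (s k) (limit_point N s k)) \<longlonglongrightarrow> 0" "(\<lambda>k. metric N (t k) (limit_point N t k)) \<longlonglongrightarrow> 0"
      using limit_point(2)[OF s] limit_point(2)[OF t] by (simp_all add: same_limit_def)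
    show "\<forall>\<^sub>F k in sequentially. \<bar>metric N (s k) (t k) - metric N (limit_point N s k) (limit_point N t k)\<bar>
        \<le> metric N (s k) (limit_point N s k) + metric N (t k) (limit_point N t k)"
      using cauchy_seqsD[OF s] cauchy_seqsD[OF t] cauchy_seqsD[OF limit_point(1)[OF s]]
        cauchy_seqsD[OF limit_point(1)[OF t]]
      by (intro always_eventually allI metric_quadrangle)
  qed
  from tendsto_add[OF this metric_completion_lim[OF limit_point(1)[OF s] limit_point(1)[OF t]]]
  show ?thesis
    by simp
qed

lemma metric_limit_point_const_lim:
  assumes "x \<in> points N" "t \<in> cauchy_seqs N"
  shows "(\<lambda>k. metric N x (t k)) \<longlonglongrightarrow> metric (completion N) (limit_point N (\<lambda>_. x)) (limit_point N t)"
  using metric_limit_point_lim[OF const_cauchy_seq assms(2)] assms(1) by simp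

lemma metric_completion_consts:
  assumes "x \<in> points N" "y \<in> points N"
  shows "metric (completion N) (limit_point N (\<lambda>_. x)) (limit_point N (\<lambda>_. y)) = metric N x y"
  using metric_limit_point_const_lim[OF assms(1) const_cauchy_seq[OF assms(2)]]
  by (simp add: LIMSEQ_const_iff)

lemma limit_point_coordinates:
  assumes ss: "ss \<in> tuples (cauchy_seqs N) n"
  shows "map (\<lambda>s. s k) ss \<in> tuples (points N) n"
    and "map (\<lambda>s. s k) (map (limit_point N) ss) \<in> tuples (points N) n"
    and "j < n \<Longrightarrow> (\<lambda>k. metric N (map (\<lambda>s. s k) ss ! j) (map (\<lambda>s. s k) (map (limit_point N) ss) ! j)) \<longlonglongrightarrow> 0"
    and "map (limit_point N) ss \<in> tuples (cauchy_seqs N) n"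
proof -
  have mem: "s \<in> cauchy_seqs N" if "s \<in> set ss" for s
    using ss that by (auto simp: tuples_def)
  have len: "length ss = n"
    using ss by (simp add: tuples_def)
  show "map (\<lambda>s. s k) ss \<in> tuples (points N) n"
    by (rule map_in_tuples[OF len]) (rule cauchy_seqsD[OF mem])
  show *: "map (limit_point N) ss \<in> tuples (cauchy_seqs N) n"
    by (rule map_in_tuples[OF len]) (rule limit_point(1)[OF mem])
  show "map (\<lambda>s. s k) (map (limit_point N) ss) \<in> tuples (points N) n"
    unfolding map_map o_def by (rule map_in_tuples[OF len]) (rule cauchy_seqsD[OF limit_point(1)[OF mem]])
  show "(\<lambda>k. metric N (map (\<lambda>s. s k) ss ! j) (map (\<lambda>s. s k) (map (limit_point N) ss) ! j)) \<longlonglongrightarrow> 0"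
    if "j < n"
    using limit_point(2)[OF tuples_nth[OF ss that]] that len by (simp add: same_limit_def)
qed

lemma fun_seq_cauchy:
  assumes F: "F \<in> funs L" and ss: "ss \<in> tuples (cauchy_seqs N) (fun_arity L F)"
  shows "(\<lambda>k. fun_interp N F (map (\<lambda>s. s k) ss)) \<in> cauchy_seqs N"
proof -
  have tup: "map (\<lambda>s. s k) ss \<in> tuples (points N) (fun_arity L F)" for k
    using ss by (rule limit_point_coordinates(1))
  have "((\<lambda>p. metric N (fun_interp N F (map (\<lambda>s. s (fst p)) ss)) (fun_interp N F (map (\<lambda>s. s (snd p)) ss))) \<longlongrightarrow> 0)
      (sequentially \<times>\<^sub>F sequentially)"
  proof (rule fun_tendsto[OF F])
    fix j
    assume "j < fun_arity L F"
    moreover from this ss have "ss ! j \<in> cauchy_seqs N"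
      by (rule tuples_nth[rotated])
    ultimately show "((\<lambda>i. metric N (map (\<lambda>s. s (fst i)) ss ! j) (map (\<lambda>s. s (snd i)) ss ! j)) \<longlongrightarrow> 0)
        (sequentially \<times>\<^sub>F sequentially)"
      using ss by (simp add: tuples_def cauchy_seqs_def case_prod_unfold)
  qed (simp_all add: tup)
  then show ?thesis
    using fun_closed[OF F tup] by (auto simp: cauchy_seqs_def case_prod_unfold)
qed

lemma pred_seq_convergent:
  assumes P: "P \<in> preds L" and ss: "ss \<in> tuples (cauchy_seqs N) (pred_arity L P)"
  shows "convergent (\<lambda>k. pred_interp N P (map (\<lambda>s. s k) ss))"
proof (rule convergent_if_differences_vanish)
  have tup: "map (\<lambda>s. s k) ss \<in> tuples (points N) (pred_arity L P)" for k
    using ss by (rule limit_point_coordinates(1))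
  have "((\<lambda>p. pred_interp N P (map (\<lambda>s. s (fst p)) ss) - pred_interp N P (map (\<lambda>s. s (snd p)) ss)) \<longlongrightarrow> 0)
      (sequentially \<times>\<^sub>F sequentially)"
  proof (rule pred_tendsto[OF P])
    fix j
    assume "j < pred_arity L P"
    moreover from this ss have "ss ! j \<in> cauchy_seqs N"
      by (rule tuples_nth[rotated])
    ultimately show "((\<lambda>i. metric N (map (\<lambda>s. s (fst i)) ss ! j) (map (\<lambda>s. s (snd i)) ss ! j)) \<longlongrightarrow> 0)
        (sequentially \<times>\<^sub>F sequentially)"
      using ss by (simp add: tuples_def cauchy_seqs_def case_prod_unfold)
  qed (simp_all add: tup)
  then show "((\<lambda>(a, b). pred_interp N P (map (\<lambda>s. s a) ss) - pred_interp N P (map (\<lambda>s. s b) ss)) \<longlongrightarrow> 0)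
      (sequentially \<times>\<^sub>F sequentially)"
    by (simp add: case_prod_unfold)
qed

lemma fun_interp_completion:
  assumes F: "F \<in> funs L" and ss: "ss \<in> tuples (cauchy_seqs N) (fun_arity L F)"
  shows "fun_interp (completion N) F (map (limit_point N) ss)
    = limit_point N (\<lambda>k. fun_interp N F (map (\<lambda>s. s k) ss))"
proof -
  note c = limit_point_coordinates[OF ss]
  have "same_limit N (\<lambda>k. fun_interp N F (map (\<lambda>s. s k) ss))
      (\<lambda>k. fun_interp N F (map (\<lambda>s. s k) (map (limit_point N) ss)))"
    unfolding same_limit_def using c by (intro fun_tendsto[OF F] always_eventually allI)
  then have "limit_point N (\<lambda>k. fun_interp N F (map (\<lambda>s. s k) ss))
      = limit_point N (\<lambda>k. fun_interp N F (map (\<lambda>s. s k) (map (limit_point N) ss)))"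
    using fun_seq_cauchy[OF F ss] fun_seq_cauchy[OF F c(4)] by (intro limit_point_eqI)
  then show ?thesis
    by (simp add: completion_def)
qed

lemma pred_interp_completion_lim:
  assumes P: "P \<in> preds L" and ss: "ss \<in> tuples (cauchy_seqs N) (pred_arity L P)"
  shows "(\<lambda>k. pred_interp N P (map (\<lambda>s. s k) ss)) \<longlonglongrightarrow> pred_interp (completion N) P (map (limit_point N) ss)"
proof -
  note c = limit_point_coordinates[OF ss]
  have "(\<lambda>k. pred_interp N P (map (\<lambda>s. s k) ss) - pred_interp N P (map (\<lambda>s. s k) (map (limit_point N) ss))) \<longlonglongrightarrow> 0"
    using c by (intro pred_tendsto[OF P] always_eventually allI)
  moreover have "(\<lambda>k. pred_interp N P (map (\<lambda>s. s k) (map (limit_point N) ss)))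
      \<longlonglongrightarrow> pred_interp (completion N) P (map (limit_point N) ss)"
  proof -
    have "pred_interp (completion N) P (map (limit_point N) ss)
        = lim (\<lambda>k. pred_interp N P (map (\<lambda>s. s k) (map (limit_point N) ss)))"
      by (simp add: completion_def)
    then show ?thesis
      using pred_seq_convergent[OF P c(4)] unfolding convergent_LIMSEQ_iff by (simp only:)
  qed
  ultimately show ?thesis
    using tendsto_add by fastforce
qed

lemma tuples_completion:
  assumes "ps \<in> tuples (points (completion N)) n"
  shows "ps \<in> tuples (cauchy_seqs N) n" "map (limit_point N) ps = ps"
  using assms by (auto simp: tuples_def points_completion subset_iff intro!: map_idI)

lemma prestructure_completion: "prestructure L (completion N)"
proof
  show "is_signature L"
    by (rule signature)
  show "points (completion N) \<noteq> {}"
    using nonempty const_cauchy_seq by (auto simp: completion_def)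
next
  fix p
  assume "p \<in> points (completion N)"
  then show "metric (completion N) p p = 0"
    using metric_completion_lim[of p p]
    by (simp add: points_completion metric_self cauchy_seqsD LIMSEQ_const_iff)
next
  fix p q
  assume pq: "p \<in> points (completion N)" "q \<in> points (completion N)"
  then have "(\<lambda>k. metric N (q k) (p k)) \<longlonglongrightarrow> metric (completion N) p q"
    using metric_completion_lim[of p q] by (simp add: points_completion metric_sym cauchy_seqsD)
  then show "metric (completion N) p q = metric (completion N) q p"
    using pq metric_completion_lim[of q p] LIMSEQ_unique by (auto simp: points_completion)
  show "metric (completion N) p q \<le> 1"
    using pq cauchy_seqsD[of p] cauchy_seqsD[of q]
    by (intro LIMSEQ_le_const2[OF metric_completion_lim[of p q]])
      (auto simp: points_completion intro!: metric_le_1)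
next
  fix p q r
  assume *: "p \<in> points (completion N)" "q \<in> points (completion N)" "r \<in> points (completion N)"
  then have "(\<lambda>k. metric N (p k) (q k) + metric N (q k) (r k)) \<longlonglongrightarrow> metric (completion N) p q + metric (completion N) q r"
    by (intro tendsto_add metric_completion_lim) (auto simp: points_completion)
  then show "metric (completion N) p r \<le> metric (completion N) p q + metric (completion N) q r"
    using * cauchy_seqsD[of p] cauchy_seqsD[of q] cauchy_seqsD[of r]
    by (intro LIMSEQ_le[OF metric_completion_lim[of p r]])
      (auto simp: points_completion intro!: metric_triangle)
next
  fix F ps
  assume F: "F \<in> funs L" and ps: "ps \<in> tuples (points (completion N)) (fun_arity L F)"
  note ps' = tuples_completion[OF ps]
  then show "fun_interp (completion N) F ps \<in> points (completion N)"
    using fun_interp_completion[OF F ps'(1)] fun_seq_cauchy[OF F ps'(1)]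
    by (simp add: limit_point_in_completion)
  fix qs \<epsilon>
  assume qs: "qs \<in> tuples (points (completion N)) (fun_arity L F)" and \<epsilon>: "\<epsilon> \<in> {0<..1::real}"
    and close: "\<forall>i<fun_arity L F. metric (completion N) (ps ! i) (qs ! i) < fun_modulus L F \<epsilon>"
  note qs' = tuples_completion[OF qs]
  have "\<forall>\<^sub>F k in sequentially. metric N (map (\<lambda>p. p k) ps ! i) (map (\<lambda>p. p k) qs ! i) < fun_modulus L F \<epsilon>"
    if "i < fun_arity L F" for i
  proof -
    have "(\<lambda>k. metric N ((ps ! i) k) ((qs ! i) k)) \<longlonglongrightarrow> metric (completion N) (ps ! i) (qs ! i)"
      using that ps'(1) qs'(1) by (intro metric_completion_lim tuples_nth)
    from order_tendstoD(2)[OF this] that close ps'(1) qs'(1) show ?thesis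
      by (simp add: tuples_def)
  qed
  then have "\<forall>\<^sub>F k in sequentially. \<forall>i\<in>{..<fun_arity L F}.
      metric N (map (\<lambda>p. p k) ps ! i) (map (\<lambda>p. p k) qs ! i) < fun_modulus L F \<epsilon>"
    by (intro eventually_ball_finite) auto
  then have "\<forall>\<^sub>F k in sequentially.
      metric N (fun_interp N F (map (\<lambda>p. p k) ps)) (fun_interp N F (map (\<lambda>p. p k) qs)) \<le> \<epsilon>"
    by eventually_elim
      (use \<epsilon> in \<open>auto intro!: fun_ucont[OF F limit_point_coordinates(1)[OF ps'(1)] limit_point_coordinates(1)[OF qs'(1)]]\<close>)
  then show "metric (completion N) (fun_interp (completion N) F ps) (fun_interp (completion N) F qs) \<le> \<epsilon>"
    using fun_interp_completion[OF F ps'(1)] fun_interp_completion[OF F qs'(1)] ps'(2) qs'(2)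
      metric_limit_point_lim[OF fun_seq_cauchy[OF F ps'(1)] fun_seq_cauchy[OF F qs'(1)]]
    by (auto intro: tendsto_upperbound)
next
  fix P ps
  assume P: "P \<in> preds L" and ps: "ps \<in> tuples (points (completion N)) (pred_arity L P)"
  note ps' = tuples_completion[OF ps]
  note lim = pred_interp_completion_lim[OF P ps'(1), unfolded ps'(2)]
  have unit: "pred_interp N P (map (\<lambda>p. p k) ps) \<in> {0..1}" for k
    using P limit_point_coordinates(1)[OF ps'(1)] by (rule pred_unit)
  show "pred_interp (completion N) P ps \<in> {0..1}"
    using unit by (intro closed_sequentially[OF _ _ lim]) auto
  fix qs \<epsilon>
  assume qs: "qs \<in> tuples (points (completion N)) (pred_arity L P)" and \<epsilon>: "\<epsilon> \<in> {0<..1::real}"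
    and close: "\<forall>i<pred_arity L P. metric (completion N) (ps ! i) (qs ! i) < pred_modulus L P \<epsilon>"
  note qs' = tuples_completion[OF qs]
  have "\<forall>\<^sub>F k in sequentially. metric N (map (\<lambda>p. p k) ps ! i) (map (\<lambda>p. p k) qs ! i) < pred_modulus L P \<epsilon>"
    if "i < pred_arity L P" for i
  proof -
    have "(\<lambda>k. metric N ((ps ! i) k) ((qs ! i) k)) \<longlonglongrightarrow> metric (completion N) (ps ! i) (qs ! i)"
      using that ps'(1) qs'(1) by (intro metric_completion_lim tuples_nth)
    from order_tendstoD(2)[OF this] that close ps'(1) qs'(1) show ?thesis
      by (simp add: tuples_def)
  qed
  then have "\<forall>\<^sub>F k in sequentially. \<forall>i\<in>{..<pred_arity L P}.
      metric N (map (\<lambda>p. p k) ps ! i) (map (\<lambda>p. p k) qs ! i) < pred_modulus L P \<epsilon>"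
    by (intro eventually_ball_finite) auto
  then have "\<forall>\<^sub>F k in sequentially.
      \<bar>pred_interp N P (map (\<lambda>p. p k) ps) - pred_interp N P (map (\<lambda>p. p k) qs)\<bar> \<le> \<epsilon>"
    by eventually_elim
      (use \<epsilon> in \<open>auto intro!: pred_ucont[OF P limit_point_coordinates(1)[OF ps'(1)] limit_point_coordinates(1)[OF qs'(1)]]\<close>)
  then show "\<bar>pred_interp (completion N) P ps - pred_interp (completion N) P qs\<bar> \<le> \<epsilon>"
    using tendsto_rabs[OF tendsto_diff[OF lim pred_interp_completion_lim[OF P qs'(1), unfolded qs'(2)]]]
    by (auto intro: tendsto_upperbound)
qed

lemma completion_zero:
  assumes "p \<in> points (completion N)" "q \<in> points (completion N)" "metric (completion N) p q = 0"
  shows "p = q"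
  using assms metric_completion_lim[of p q] limit_point_eqI[of p q]
  by (simp add: points_completion same_limit_def)

lemma completion_approx:
  assumes p: "p \<in> points (completion N)" and "0 < e"
  obtains x where "x \<in> points N" "metric (completion N) p (limit_point N (\<lambda>_. x)) \<le> e"
proof -
  from p have p': "p \<in> cauchy_seqs N" "limit_point N p = p"
    by (auto simp: points_completion)
  then obtain K where K: "\<And>a b. K \<le> a \<Longrightarrow> K \<le> b \<Longrightarrow> metric N (p a) (p b) < e"
    using cauchy_seq_eventually_close \<open>0 < e\<close> by blast
  have "metric (completion N) p (limit_point N (\<lambda>_. p K)) \<le> e"
    using metric_limit_point_lim[OF p'(1) const_cauchy_seq[OF cauchy_seqsD[OF p'(1)]], of K] K p'(2)
    by (intro LIMSEQ_le_const2) (auto intro!: exI[of _ K] less_imp_le)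
  then show thesis
    using that cauchy_seqsD[OF p'(1)] by blast
qed

text \<open>Only completeness needs an argument: approximate the \<open>k\<close>-th term of a Cauchy sequence in the
  completion by a point \<open>x k\<close> of \<open>N\<close> up to \<open>1 / (k + 1)\<close>. Then \<open>x\<close> is a Cauchy sequence in \<open>N\<close>, and the
  point that it represents is the limit.\<close>

lemma is_structure_completion: "is_structure L (completion N)"
proof -
  interpret C: prestructure L "completion N"
    by (rule prestructure_completion)
  have nonneg: "0 \<le> metric (completion N) p q" for p q
  proof (cases "p \<in> cauchy_seqs N \<and> q \<in> cauchy_seqs N")
    case True
    then show ?thesis
      using cauchy_seqsD[of p] cauchy_seqsD[of q]
      by (intro LIMSEQ_le_const[OF metric_completion_lim[of p q]]) (auto intro!: metric_nonneg)
  qed (auto simp: completion_def)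
  have sym: "metric (completion N) p q = metric (completion N) q p" for p q
    by (auto simp: completion_def metric_sym cauchy_seqsD intro!: arg_cong[where f = lim])
  interpret Metric_space "points (completion N)" "metric (completion N)"
    by unfold_locales
      (use nonneg sym C.metric_self completion_zero C.metric_triangle in \<open>auto\<close>)
  have mcomplete
    unfolding mcomplete_def
  proof (intro allI impI)
    fix \<sigma>
    assume \<sigma>: "MCauchy \<sigma>"
    then have \<sigma>_points: "\<sigma> k \<in> points (completion N)" for k
      by (auto simp: MCauchy_def)
    have "\<exists>x. x \<in> points N \<and> metric (completion N) (\<sigma> k) (limit_point N (\<lambda>_. x)) \<le> 1 / real (Suc k)" for k
      by (rule completion_approx[OF \<sigma>_points[of k], of "1 / real (Suc k)"]) (simp, blast)
    then obtain x where x: "\<And>k. x k \<in> points N"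
      and \<sigma>x: "\<And>k. metric (completion N) (\<sigma> k) (limit_point N (\<lambda>_. x k)) \<le> 1 / real (Suc k)"
      by metis
    define c where "c k = limit_point N (\<lambda>_. x k)" for k
    have c: "c k \<in> points (completion N)" for k
      unfolding c_def by (intro limit_point_in_completion const_cauchy_seq x)
    have small: "\<exists>K. \<forall>k\<ge>K. 1 / real (Suc k) < e" if e: "0 < e" for e :: real
    proof -
      obtain K where K: "1 / real (Suc K) < e"
        using nat_approx_posE[OF e] by blast
      have "1 / real (Suc k) \<le> 1 / real (Suc K)" if "K \<le> k" for k
        using that by (simp add: frac_le)
      with K show ?thesis
        by (meson le_less_trans)
    qed
    have "x \<in> cauchy_seqs N"
      unfolding cauchy_seqs_def
    proof (intro CollectI conjI tendstoI)
      show "range x \<subseteq> points N"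
        using x by auto
      fix e :: real
      assume "0 < e"
      then obtain K1 where K1: "\<And>k. K1 \<le> k \<Longrightarrow> 1 / real (Suc k) < e / 3"
        using small[of "e / 3"] by auto
      obtain K2 where K2: "\<And>a b. K2 \<le> a \<Longrightarrow> K2 \<le> b \<Longrightarrow> metric (completion N) (\<sigma> a) (\<sigma> b) < e / 3"
        using \<sigma> \<open>0 < e\<close> unfolding MCauchy_def by (meson divide_pos_pos zero_less_numeral)
      have "metric N (x a) (x b) < e" if "max K1 K2 \<le> a" "max K1 K2 \<le> b" for a b
      proof -
        have "metric N (x a) (x b) = metric (completion N) (c a) (c b)"
          using metric_completion_consts[OF x x] by (simp add: c_def)
        also have "\<dots> \<le> metric (completion N) (c a) (\<sigma> a) + (metric (completion N) (\<sigma> a) (\<sigma> b) + metric (completion N) (\<sigma> b) (c b))"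
          using triangle[OF c[of a] \<sigma>_points[of a] c[of b]] triangle[OF \<sigma>_points[of a] \<sigma>_points[of b] c[of b]]
          by simp
        also have "\<dots> < e"
          using \<sigma>x[of a] \<sigma>x[of b] K1[of a] K1[of b] K2[of a b] that sym[of "\<sigma> a" "c a"]
          by (simp add: c_def)
        finally show ?thesis .
      qed
      then show "\<forall>\<^sub>F p in sequentially \<times>\<^sub>F sequentially. dist (case p of (a, b) \<Rightarrow> metric N (x a) (x b)) 0 < e"
        unfolding eventually_prod_sequentially
        by (intro exI[of _ "max K1 K2"]) (simp add: metric_nonneg[OF x x])
    qed
    define l where "l = limit_point N x"
    have l: "l \<in> points (completion N)"
      unfolding l_def by (intro limit_point_in_completion \<open>x \<in> cauchy_seqs N\<close>)
    have "\<exists>K. \<forall>k\<ge>K. metric (completion N) (\<sigma> k) l < e" if "0 < e" for e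
    proof -
      obtain K1 where K1: "\<And>k. K1 \<le> k \<Longrightarrow> 1 / real (Suc k) < e / 2"
        using small[of "e / 2"] \<open>0 < e\<close> by auto
      obtain K2 where K2: "\<And>a b. K2 \<le> a \<Longrightarrow> K2 \<le> b \<Longrightarrow> metric N (x a) (x b) < e / 2"
        using cauchy_seq_eventually_close[OF \<open>x \<in> cauchy_seqs N\<close>] \<open>0 < e\<close> by (metis half_gt_zero)
      have "metric (completion N) (\<sigma> k) l < e" if "max K1 K2 \<le> k" for k
      proof -
        have "metric (completion N) (c k) l \<le> e / 2"
          unfolding c_def l_def using K2 that
          by (intro LIMSEQ_le_const2[OF metric_limit_point_const_lim[OF x \<open>x \<in> cauchy_seqs N\<close>]])
            (auto intro!: exI[of _ K2] less_imp_le)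
        then show ?thesis
          using triangle[OF \<sigma>_points[of k] c[of k] l] \<sigma>x[of k] K1[of k] that by (simp add: c_def)
      qed
      then show ?thesis
        by blast
    qed
    then have "limitin mtopology \<sigma> l sequentially"
      using l \<sigma>_points by (auto simp: limit_metric_sequentially)
    then show "\<exists>l. limitin mtopology \<sigma> l sequentially"
      by blast
  qed
  then show ?thesis
    using signature C.prestructure_axioms Metric_space_axioms by (simp add: is_structure_iff_prestructure)
qed

text \<open>Function symbols act termwise on Cauchy sequences, hence so do terms.\<close>

lemma tval_completion:
  assumes "\<And>v. \<sigma> v \<in> cauchy_seqs N" "wf_trm L t"
  shows "(\<lambda>k. tval N (\<lambda>v. \<sigma> v k) t) \<in> cauchy_seqs N \<and>
    tval (completion N) (\<lambda>v. limit_point N (\<sigma> v)) t = limit_point N (\<lambda>k. tval N (\<lambda>v. \<sigma> v k) t)"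
  using assms(2)
proof (induction t)
  case (Var i)
  then show ?case
    using assms(1)[of i] by simp
next
  case (App F ts)
  define ss where "ss = map (\<lambda>t k. tval N (\<lambda>v. \<sigma> v k) t) ts"
  have F: "F \<in> funs L" and ss: "ss \<in> tuples (cauchy_seqs N) (fun_arity L F)"
    using App by (auto simp: ss_def intro!: map_in_tuples)
  have "map (tval (completion N) (\<lambda>v. limit_point N (\<sigma> v))) ts = map (limit_point N) ss"
    using App by (simp add: ss_def)
  moreover have "map (\<lambda>s. s k) ss = map (tval N (\<lambda>v. \<sigma> v k)) ts" for k
    by (simp add: ss_def)
  ultimately show ?case
    using fun_seq_cauchy[OF F ss] fun_interp_completion[OF F ss] by (simp only: tval.simps)
qed

lemma fval_completion_lim:
  assumes \<sigma>: "\<And>v. \<sigma> v \<in> cauchy_seqs N" and "wf_fm L \<phi>" "quantifier_free \<phi>"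
  shows "(\<lambda>k. fval N (\<lambda>v. \<sigma> v k) \<phi>) \<longlonglongrightarrow> fval (completion N) (\<lambda>v. limit_point N (\<sigma> v)) \<phi>"
proof (rule quantifier_free_fval_tendsto[OF prestructure_axioms prestructure_completion _ _ _ _ assms(2,3)])
  show "\<forall>\<^sub>F k in sequentially. range (\<lambda>v. \<sigma> v k) \<subseteq> points N"
    using cauchy_seqsD[OF \<sigma>] by (intro always_eventually) auto
  show "range (\<lambda>v. limit_point N (\<sigma> v)) \<subseteq> points (completion N)"
    using limit_point_in_completion[OF \<sigma>] by auto
  show "(\<lambda>k. fval N (\<lambda>v. \<sigma> v k) (Dist t t')) \<longlonglongrightarrow> fval (completion N) (\<lambda>v. limit_point N (\<sigma> v)) (Dist t t')"
    if "wf_trm L t" "wf_trm L t'" for t t'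
    using metric_limit_point_lim tval_completion[OF \<sigma> that(1)] tval_completion[OF \<sigma> that(2)] by simp
  show "(\<lambda>k. fval N (\<lambda>v. \<sigma> v k) (Pred P ts)) \<longlonglongrightarrow> fval (completion N) (\<lambda>v. limit_point N (\<sigma> v)) (Pred P ts)"
    if "wf_fm L (Pred P ts)" for P ts
  proof -
    define ss where "ss = map (\<lambda>t k. tval N (\<lambda>v. \<sigma> v k) t) ts"
    have P: "P \<in> preds L" and ss: "ss \<in> tuples (cauchy_seqs N) (pred_arity L P)"
      using that tval_completion[OF \<sigma>] by (auto simp: ss_def intro!: map_in_tuples)
    have "map (tval (completion N) (\<lambda>v. limit_point N (\<sigma> v))) ts = map (limit_point N) ss"
      using that tval_completion[OF \<sigma>] by (simp add: ss_def)
    moreover have "map (\<lambda>s. s k) ss = map (tval N (\<lambda>v. \<sigma> v k)) ts" for k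
      by (simp add: ss_def)
    ultimately show ?thesis
      using pred_interp_completion_lim[OF P ss] by (simp only: fval.simps)
  qed
qed

end

section \<open>Universal and existential sentences\<close>

context prestructure
begin

text \<open>Since formulas are nonnegative, a supremum is 0 iff all its instances are. A universal
  condition therefore says that a quantifier-free formula vanishes identically.\<close>

lemma universal_sentence_holds_iff:
  assumes "wf_fm L \<phi>"
  shows "(\<forall>s. range s \<subseteq> points N \<longrightarrow> fval N s (foldr QSup xs \<phi>) = 0) \<longleftrightarrow>
    (\<forall>s. range s \<subseteq> points N \<longrightarrow> fval N s \<phi> = 0)"
proof (induction xs)
  case (Cons i xs)
  define \<psi> where "\<psi> = foldr QSup xs \<phi>"
  have \<psi>: "wf_fm L \<psi>"
    unfolding \<psi>_def using assms by (induction xs) auto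
  have "(\<forall>s. range s \<subseteq> points N \<longrightarrow> fval N s (QSup i \<psi>) = 0) \<longleftrightarrow>
      (\<forall>s. range s \<subseteq> points N \<longrightarrow> fval N s \<psi> = 0)"
  proof (intro iffI allI impI)
    fix s :: "nat \<Rightarrow> 'a"
    assume zero: "\<forall>s. range s \<subseteq> points N \<longrightarrow> fval N s (QSup i \<psi>) = 0" and s: "range s \<subseteq> points N"
    then have "fval N (s(i := s i)) \<psi> \<le> 0"
      using fval_instance_le_sup[OF \<psi> s, of "s i" i] by (metis range_subsetD)
    then show "fval N s \<psi> = 0"
      using fval_unit[OF \<psi> s] by simp
  next
    fix s :: "nat \<Rightarrow> 'a"
    assume zero: "\<forall>s. range s \<subseteq> points N \<longrightarrow> fval N s \<psi> = 0" and s: "range s \<subseteq> points N"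
    have "fval N (s(i := a)) \<psi> = 0" if "a \<in> points N" for a
      using s that by (intro zero[rule_format]) auto
    then show "fval N s (QSup i \<psi>) = 0"
      using nonempty by (simp cong: SUP_cong_simp)
  qed
  with Cons show ?case
    by (simp add: \<psi>_def)
qed simp

end

text \<open>Infima can only decrease when the structure grows, so an existential condition that holds in
  a structure holds in its extensions.\<close>

lemma existential_value_le_along_embedding:
  assumes "prestructure L M" "prestructure L N"
    and e: "\<And>x. x \<in> points M \<Longrightarrow> e x \<in> points N"
    and qf: "\<And>s. range s \<subseteq> points M \<Longrightarrow> fval N (\<lambda>v. e (s v)) \<phi> = fval M s \<phi>"
    and \<phi>: "wf_fm L \<phi>" and s: "range s \<subseteq> points M"
  shows "fval N (\<lambda>v. e (s v)) (foldr QInf xs \<phi>) \<le> fval M s (foldr QInf xs \<phi>)"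
  using s
proof (induction xs arbitrary: s)
  case Nil
  then show ?case
    using qf by simp
next
  case (Cons i xs)
  interpret M: prestructure L M
    by fact
  interpret N: prestructure L N
    by fact
  define \<psi> where "\<psi> = foldr QInf xs \<phi>"
  have \<psi>: "wf_fm L \<psi>"
    unfolding \<psi>_def using \<phi> by (induction xs) auto
  have "fval N (\<lambda>v. e (s v)) (QInf i \<psi>) \<le> fval M (s(i := a)) \<psi>" if a: "a \<in> points M" for a
  proof -
    have "fval N (\<lambda>v. e (s v)) (QInf i \<psi>) \<le> fval N ((\<lambda>v. e (s v))(i := e a)) \<psi>"
      using Cons.prems a e by (intro N.fval_inf_le_instance[OF \<psi>]) auto
    also have "(\<lambda>v. e (s v))(i := e a) = (\<lambda>v. e ((s(i := a)) v))"
      by auto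
    also have "fval N \<dots> \<psi> \<le> fval M (s(i := a)) \<psi>"
      unfolding \<psi>_def using Cons.prems a by (intro Cons.IH) auto
    finally show ?thesis .
  qed
  then have "fval N (\<lambda>v. e (s v)) (QInf i \<psi>) \<le> fval M s (QInf i \<psi>)"
    using M.nonempty by (simp only: fval.simps(5)[of M]) (rule cINF_greatest, auto)
  then show ?case
    by (simp add: \<psi>_def)
qed

section \<open>The limit of a structure along a filter of parameter tuples\<close>

definition param_terms :: "('f, 'p) signature \<Rightarrow> ('f, 'p, 'm) metric_structure \<Rightarrow> nat \<Rightarrow> ('f + 'm) trm set" where
  "param_terms L M n = {t. wf_trm (sig_consts L (points M)) t \<and> fv_trm t \<subseteq> {..<n}}"

definition eval_at :: "('f, 'p, 'm) metric_structure \<Rightarrow> 'm list \<Rightarrow> ('f + 'm) trm \<Rightarrow> 'm" where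
  "eval_at M as = tval (struct_consts M) ((!) as)"

text \<open>If \<open>G\<close> is an ultrafilter, this is the substructure of the ultrapower of \<open>M\<close> generated by \<open>M\<close> and the
  classes of the coordinate functions, before points at distance 0 are identified. It also makes sense
  for any filter along which the atomic formulas converge.\<close>

definition term_structure ::
    "('f, 'p) signature \<Rightarrow> ('f, 'p, 'm) metric_structure \<Rightarrow> nat \<Rightarrow> 'm list filter
      \<Rightarrow> ('f, 'p, ('f + 'm) trm) metric_structure" where
  "term_structure L M n G =
     \<lparr>points = param_terms L M n,
      metric = \<lambda>t t'. Lim G (\<lambda>as. metric M (eval_at M as t) (eval_at M as t')),
      fun_interp = \<lambda>F. App (Inl F),
      pred_interp = \<lambda>P ts. Lim G (\<lambda>as. pred_interp M P (map (eval_at M as) ts))\<rparr>"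

lemma eval_at_simps [simp]:
  "eval_at M as (App (Inl F) ts) = fun_interp M F (map (eval_at M as) ts)"
  "eval_at M as (App (Inr c) ts) = c"
  "eval_at M as (Var v) = as ! v"
  by (simp_all add: eval_at_def struct_consts_def)

lemma param_terms_simps [simp]:
  "App (Inr c) [] \<in> param_terms L M n \<longleftrightarrow> c \<in> points M"
  "Var v \<in> param_terms L M n \<longleftrightarrow> v < n"
  by (auto simp: param_terms_def sig_consts_def)

lemma App_in_param_terms:
  "F \<in> funs L \<Longrightarrow> ts \<in> tuples (param_terms L M n) (fun_arity L F) \<Longrightarrow> App (Inl F) ts \<in> param_terms L M n"
  by (auto simp: param_terms_def sig_consts_def tuples_def)

lemma (in prestructure) eval_at_in_points:
  assumes "t \<in> param_terms L N n" "as \<in> tuples (points N) n"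
  shows "eval_at N as t \<in> points N"
proof -
  have "wf_trm (sig_consts L (points N)) t \<Longrightarrow> fv_trm t \<subseteq> {..<n} \<Longrightarrow> eval_at N as t \<in> points N" for t
  proof (induction t)
    case (Var v)
    then show ?case
      using assms(2) by (auto intro: tuples_nth)
  next
    case (App F ts)
    show ?case
    proof (cases F)
      case (Inl F')
      with App show ?thesis
        by (auto simp: sig_consts_def intro!: fun_closed map_in_tuples)
    next
      case (Inr c)
      with App show ?thesis
        by (auto simp: sig_consts_def)
    qed
  qed
  with assms(1) show ?thesis
    by (auto simp: param_terms_def)
qed

text \<open>The convergence of the values of the atomic formulas in the terms is all that is needed of an
  ultrafilter.\<close>

locale term_limit = M: prestructure L M
  for L :: "('f, 'p) signature" and M :: "('f, 'p, 'm) metric_structure" +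
  fixes n :: nat and G :: "'m list filter"
  assumes G_proper: "G \<noteq> bot"
    and G_tuples: "\<forall>\<^sub>F as in G. as \<in> tuples (points M) n"
    and metric_converges: "t \<in> param_terms L M n \<Longrightarrow> t' \<in> param_terms L M n \<Longrightarrow>
      \<exists>l. ((\<lambda>as. metric M (eval_at M as t) (eval_at M as t')) \<longlongrightarrow> l) G"
    and pred_converges: "P \<in> preds L \<Longrightarrow> ts \<in> tuples (param_terms L M n) (pred_arity L P) \<Longrightarrow>
      \<exists>l. ((\<lambda>as. pred_interp M P (map (eval_at M as) ts)) \<longlongrightarrow> l) G"
begin

abbreviation "TS \<equiv> term_structure L M n G"

lemma points_TS [simp]: "points TS = param_terms L M n"
  by (simp add: term_structure_def)

lemma fun_interp_TS [simp]: "fun_interp TS F = App (Inl F)"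
  by (simp add: term_structure_def)

lemma metric_TS_lim:
  assumes "t \<in> param_terms L M n" "t' \<in> param_terms L M n"
  shows "((\<lambda>as. metric M (eval_at M as t) (eval_at M as t')) \<longlongrightarrow> metric TS t t') G"
proof -
  obtain l where l: "((\<lambda>as. metric M (eval_at M as t) (eval_at M as t')) \<longlongrightarrow> l) G"
    using metric_converges[OF assms] by blast
  then have "metric TS t t' = l"
    using tendsto_Lim[OF G_proper l] by (simp add: term_structure_def)
  with l show ?thesis
    by simp
qed

lemma pred_TS_lim:
  assumes "P \<in> preds L" "ts \<in> tuples (param_terms L M n) (pred_arity L P)"
  shows "((\<lambda>as. pred_interp M P (map (eval_at M as) ts)) \<longlongrightarrow> pred_interp TS P ts) G"
proof -
  obtain l where l: "((\<lambda>as. pred_interp M P (map (eval_at M as) ts)) \<longlongrightarrow> l) G"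
    using pred_converges[OF assms] by blast
  then have "pred_interp TS P ts = l"
    using tendsto_Lim[OF G_proper l] by (simp add: term_structure_def)
  with l show ?thesis
    by simp
qed

lemma eval_at_tuples:
  "as \<in> tuples (points M) n \<Longrightarrow> ts \<in> tuples (param_terms L M n) k \<Longrightarrow> map (eval_at M as) ts \<in> tuples (points M) k"
  by (rule map_in_tuples) (auto simp: tuples_def subset_iff intro: M.eval_at_in_points)

lemma eventually_close_coordinates:
  assumes ts: "ts \<in> tuples (param_terms L M n) k" and ts': "ts' \<in> tuples (param_terms L M n) k"
    and close: "\<forall>i<k. metric TS (ts ! i) (ts' ! i) < r"
  shows "\<forall>\<^sub>F as in G. \<forall>i<k. metric M (map (eval_at M as) ts ! i) (map (eval_at M as) ts' ! i) < r"
proof -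
  have "\<forall>\<^sub>F as in G. metric M (map (eval_at M as) ts ! i) (map (eval_at M as) ts' ! i) < r" if "i < k" for i
    using order_tendstoD(2)[OF metric_TS_lim[OF tuples_nth[OF ts that] tuples_nth[OF ts' that]]] close that ts ts'
    by (simp add: tuples_def)
  then have "\<forall>\<^sub>F as in G. \<forall>i\<in>{..<k}. metric M (map (eval_at M as) ts ! i) (map (eval_at M as) ts' ! i) < r"
    by (intro eventually_ball_finite) auto
  then show ?thesis
    by eventually_elim simp
qed

lemma prestructure_TS: "prestructure L TS"
proof
  show "is_signature L"
    by (rule M.signature)
  obtain c where "c \<in> points M"
    using M.nonempty by blast
  then have "App (Inr c) [] \<in> points TS"
    by simp
  then show "points TS \<noteq> {}"
    by blast
next
  fix t
  assume t: "t \<in> points TS"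
  have "\<forall>\<^sub>F as in G. metric M (eval_at M as t) (eval_at M as t) = 0"
    using G_tuples by eventually_elim (use t M.metric_self M.eval_at_in_points in auto)
  then have "((\<lambda>as. metric M (eval_at M as t) (eval_at M as t)) \<longlongrightarrow> 0) G"
    by (rule tendsto_eventually)
  then show "metric TS t t = 0"
    using metric_TS_lim[of t t] t tendsto_unique[OF G_proper] by simp
next
  fix t t'
  assume t: "t \<in> points TS" "t' \<in> points TS"
  have "\<forall>\<^sub>F as in G. metric M (eval_at M as t) (eval_at M as t') = metric M (eval_at M as t') (eval_at M as t)"
    using G_tuples by eventually_elim (use t M.metric_sym M.eval_at_in_points in auto)
  from Lim_transform_eventually[OF metric_TS_lim this]
  have "((\<lambda>as. metric M (eval_at M as t') (eval_at M as t)) \<longlongrightarrow> metric TS t t') G"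
    using t by simp
  then show "metric TS t t' = metric TS t' t"
    using metric_TS_lim[of t' t] t tendsto_unique[OF G_proper] by simp
  show "metric TS t t' \<le> 1"
  proof (rule tendsto_upperbound[OF metric_TS_lim _ G_proper])
    show "\<forall>\<^sub>F as in G. metric M (eval_at M as t) (eval_at M as t') \<le> 1"
      using G_tuples by eventually_elim (use t M.metric_le_1 M.eval_at_in_points in auto)
  qed (use t in auto)
next
  fix t t' t''
  assume t: "t \<in> points TS" "t' \<in> points TS" "t'' \<in> points TS"
  show "metric TS t t'' \<le> metric TS t t' + metric TS t' t''"
  proof (rule tendsto_le[OF G_proper tendsto_add[OF metric_TS_lim metric_TS_lim] metric_TS_lim])
    show "\<forall>\<^sub>F as in G. metric M (eval_at M as t) (eval_at M as t'')
        \<le> metric M (eval_at M as t) (eval_at M as t') + metric M (eval_at M as t') (eval_at M as t'')"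
      using G_tuples by eventually_elim (use t M.metric_triangle M.eval_at_in_points in auto)
  qed (use t in auto)
next
  fix F ts
  assume F: "F \<in> funs L" and ts: "ts \<in> tuples (points TS) (fun_arity L F)"
  then show "fun_interp TS F ts \<in> points TS"
    by (simp add: App_in_param_terms)
  fix ts' \<epsilon>
  assume ts': "ts' \<in> tuples (points TS) (fun_arity L F)" and \<epsilon>: "\<epsilon> \<in> {0<..1::real}"
    and close: "\<forall>i<fun_arity L F. metric TS (ts ! i) (ts' ! i) < fun_modulus L F \<epsilon>"
  have "\<forall>\<^sub>F as in G. metric M (eval_at M as (App (Inl F) ts)) (eval_at M as (App (Inl F) ts')) \<le> \<epsilon>"
    using G_tuples eventually_close_coordinates[OF ts[simplified] ts'[simplified] close]
  proof eventually_elim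
    case (elim as)
    then show ?case
      using ts ts' by (simp add: M.fun_ucont[OF F _ _ \<epsilon>] eval_at_tuples)
  qed
  then show "metric TS (fun_interp TS F ts) (fun_interp TS F ts') \<le> \<epsilon>"
    unfolding fun_interp_TS using F ts ts'
    by (intro tendsto_upperbound[OF metric_TS_lim _ G_proper]) (auto intro!: App_in_param_terms)
next
  fix P ts
  assume P: "P \<in> preds L" and ts: "ts \<in> tuples (points TS) (pred_arity L P)"
  note lim = pred_TS_lim[OF P ts[simplified]]
  have unit: "\<forall>\<^sub>F as in G. pred_interp M P (map (eval_at M as) ts) \<in> {0..1}"
    using G_tuples by eventually_elim (use M.pred_unit[OF P] eval_at_tuples ts in auto)
  show "pred_interp TS P ts \<in> {0..1}"
    by (rule Lim_in_closed_set[OF _ unit G_proper lim]) simp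
  fix ts' \<epsilon>
  assume ts': "ts' \<in> tuples (points TS) (pred_arity L P)" and \<epsilon>: "\<epsilon> \<in> {0<..1::real}"
    and close: "\<forall>i<pred_arity L P. metric TS (ts ! i) (ts' ! i) < pred_modulus L P \<epsilon>"
  note lim' = pred_TS_lim[OF P ts'[simplified]]
  have "\<forall>\<^sub>F as in G. \<bar>pred_interp M P (map (eval_at M as) ts) - pred_interp M P (map (eval_at M as) ts')\<bar> \<le> \<epsilon>"
    using G_tuples eventually_close_coordinates[OF ts[simplified] ts'[simplified] close]
  proof eventually_elim
    case (elim as)
    then show ?case
      using ts ts' by (simp add: M.pred_ucont[OF P _ _ \<epsilon>] eval_at_tuples)
  qed
  then show "\<bar>pred_interp TS P ts - pred_interp TS P ts'\<bar> \<le> \<epsilon>"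
    by (rule tendsto_upperbound[OF tendsto_rabs[OF tendsto_diff[OF lim lim']] _ G_proper])
qed

sublocale TS: prestructure L TS
  by (rule prestructure_TS)

lemma eval_at_tval_TS: "eval_at M as (tval TS \<tau> t) = tval M (\<lambda>v. eval_at M as (\<tau> v)) t"
proof (induction t)
  case (App F ts)
  then have "map (eval_at M as) (map (tval TS \<tau>) ts) = map (tval M (\<lambda>v. eval_at M as (\<tau> v))) ts"
    by simp
  then show ?case
    by (simp only: tval.simps fun_interp_TS eval_at_simps)
qed simp

lemma fval_TS_lim:
  assumes \<tau>: "range \<tau> \<subseteq> param_terms L M n" and "wf_fm L \<phi>" "quantifier_free \<phi>"
  shows "((\<lambda>as. fval M (\<lambda>v. eval_at M as (\<tau> v)) \<phi>) \<longlongrightarrow> fval TS \<tau> \<phi>) G"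
proof (rule quantifier_free_fval_tendsto[OF M.prestructure_axioms TS.prestructure_axioms _ _ _ _ assms(2,3)])
  show "\<forall>\<^sub>F as in G. range (\<lambda>v. eval_at M as (\<tau> v)) \<subseteq> points M"
    using G_tuples by eventually_elim (use \<tau> in \<open>auto intro: M.eval_at_in_points\<close>)
  show "range \<tau> \<subseteq> points TS"
    using \<tau> by simp
  have tval: "tval TS \<tau> t \<in> param_terms L M n" if "wf_trm L t" for t
    using TS.tval_in_points[OF that, of \<tau>] \<tau> by auto
  show "((\<lambda>as. fval M (\<lambda>v. eval_at M as (\<tau> v)) (Dist t t')) \<longlongrightarrow> fval TS \<tau> (Dist t t')) G"
    if "wf_trm L t" "wf_trm L t'" for t t'
    using metric_TS_lim[OF tval[OF that(1)] tval[OF that(2)]] by (simp add: eval_at_tval_TS)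
  show "((\<lambda>as. fval M (\<lambda>v. eval_at M as (\<tau> v)) (Pred P ts)) \<longlongrightarrow> fval TS \<tau> (Pred P ts)) G"
    if "wf_fm L (Pred P ts)" for P ts
  proof -
    have "map (tval TS \<tau>) ts \<in> tuples (param_terms L M n) (pred_arity L P)"
      using that tval by (intro map_in_tuples) auto
    from pred_TS_lim[OF _ this] that show ?thesis
      by (simp add: eval_at_tval_TS o_def)
  qed
qed

lemma fval_TS_constants:
  assumes s: "range s \<subseteq> points M" and "wf_fm L \<phi>" "quantifier_free \<phi>"
  shows "fval TS (\<lambda>v. App (Inr (s v)) []) \<phi> = fval M s \<phi>"
proof (rule tendsto_unique[OF G_proper])
  show "((\<lambda>as. fval M s \<phi>) \<longlongrightarrow> fval TS (\<lambda>v. App (Inr (s v)) []) \<phi>) G"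
    using fval_TS_lim[of "\<lambda>v. App (Inr (s v)) []" \<phi>] assms by (simp add: image_subset_iff)
qed simp

definition embed :: "'m \<Rightarrow> nat \<Rightarrow> ('f + 'm) trm" where
  "embed c = limit_point TS (\<lambda>_. App (Inr c) [])"

lemma embed_in_completion: "c \<in> points M \<Longrightarrow> embed c \<in> points (completion TS)"
  by (simp add: embed_def TS.limit_point_in_completion TS.const_cauchy_seq)

lemma fval_completion_constant_terms:
  assumes "range \<tau> \<subseteq> param_terms L M n" "wf_fm L \<phi>" "quantifier_free \<phi>"
  shows "fval (completion TS) (\<lambda>v. limit_point TS (\<lambda>_. \<tau> v)) \<phi> = fval TS \<tau> \<phi>"
proof -
  have "(\<lambda>_. \<tau> v) \<in> cauchy_seqs TS" for v
    using assms(1) by (intro TS.const_cauchy_seq) auto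
  from TS.fval_completion_lim[OF this assms(2,3)] show ?thesis
    by (simp add: LIMSEQ_const_iff)
qed

lemma fval_embed:
  assumes "range s \<subseteq> points M" "wf_fm L \<phi>" "quantifier_free \<phi>"
  shows "fval (completion TS) (\<lambda>v. embed (s v)) \<phi> = fval M s \<phi>"
  unfolding embed_def using assms
  by (subst fval_completion_constant_terms) (auto simp: fval_TS_constants)

text \<open>Quantifier-free values in the completion are limits of quantifier-free values at terms, which
  are limits of values in \<open>M\<close>; so a quantifier-free formula that vanishes on \<open>M\<close> vanishes on the completion.\<close>

lemma universal_sentence_completion:
  assumes \<phi>: "wf_fm L \<phi>" "quantifier_free \<phi>"
    and zero: "\<forall>s. range s \<subseteq> points M \<longrightarrow> fval M s (foldr QSup xs \<phi>) = 0"
    and s: "range s \<subseteq> points (completion TS)"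
  shows "fval (completion TS) s (foldr QSup xs \<phi>) = 0"
proof -
  interpret C: prestructure L "completion TS"
    by (rule TS.prestructure_completion)
  have zero_M: "fval M s \<phi> = 0" if "range s \<subseteq> points M" for s
    using zero that by (simp add: M.universal_sentence_holds_iff[OF \<phi>(1)])
  have zero_TS: "fval TS \<tau> \<phi> = 0" if \<tau>: "range \<tau> \<subseteq> param_terms L M n" for \<tau>
  proof (rule tendsto_unique[OF G_proper fval_TS_lim[OF \<tau> \<phi>]])
    have "\<forall>\<^sub>F as in G. fval M (\<lambda>v. eval_at M as (\<tau> v)) \<phi> = 0"
      using G_tuples by eventually_elim (intro zero_M, use \<tau> in \<open>auto intro: M.eval_at_in_points\<close>)
    then show "((\<lambda>as. fval M (\<lambda>v. eval_at M as (\<tau> v)) \<phi>) \<longlongrightarrow> 0) G"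
      by (rule tendsto_eventually)
  qed
  have "fval (completion TS) s \<phi> = 0" if "range s \<subseteq> points (completion TS)" for s
  proof -
    have s: "s v \<in> cauchy_seqs TS" "limit_point TS (s v) = s v" for v
      using that TS.points_completion by auto
    have "fval TS (\<lambda>v. s v k) \<phi> = 0" for k
      using TS.cauchy_seqsD[OF s(1)] by (intro zero_TS) auto
    then have "(\<lambda>k. 0) \<longlonglongrightarrow> fval (completion TS) s \<phi>"
      using TS.fval_completion_lim[where \<sigma> = s, OF s(1) \<phi>] by (simp add: s(2))
    then show ?thesis
      by (simp add: LIMSEQ_const_iff)
  qed
  with s show ?thesis
    using C.universal_sentence_holds_iff[OF \<phi>(1), of xs] by blast
qed

lemma existential_sentence_completion:
  assumes \<phi>: "wf_fm L \<phi>" "quantifier_free \<phi>" and closed: "fv (foldr QInf xs \<phi>) = {}"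
    and zero: "\<forall>s. range s \<subseteq> points M \<longrightarrow> fval M s (foldr QInf xs \<phi>) = 0"
    and s: "range s \<subseteq> points (completion TS)"
  shows "fval (completion TS) s (foldr QInf xs \<phi>) = 0"
proof -
  interpret C: prestructure L "completion TS"
    by (rule TS.prestructure_completion)
  obtain c where c: "c \<in> points M"
    using M.nonempty by blast
  have wf: "wf_fm L (foldr QInf xs \<phi>)"
    using \<phi>(1) by (induction xs) auto
  have "fval (completion TS) s (foldr QInf xs \<phi>) = fval (completion TS) (\<lambda>v. embed c) (foldr QInf xs \<phi>)"
    using closed by (intro fval_cong) auto
  also have "\<dots> \<le> fval M (\<lambda>v. c) (foldr QInf xs \<phi>)"
    using existential_value_le_along_embedding[of L M "completion TS" embed \<phi> "\<lambda>v. c" xs] \<phi> c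
      embed_in_completion fval_embed M.prestructure_axioms C.prestructure_axioms by auto
  also have "\<dots> = 0"
    using zero c by auto
  finally show ?thesis
    using C.fval_unit[OF wf s] by simp
qed

text \<open>This is where the shape of the axioms of a primitive theory enters: universal conditions pass to the
  completion by taking limits, existential ones because \<open>M\<close> embeds into it.\<close>

lemma models_completion:
  assumes "models L M (\<Gamma> \<union> \<Delta>)"
    and \<Gamma>: "\<Gamma> \<subseteq> {\<sigma> \<in> sentences L. universal \<sigma>}" and \<Delta>: "\<Delta> \<subseteq> {\<sigma> \<in> sentences L. existential \<sigma>}"
  shows "models L (completion TS) (\<Gamma> \<union> \<Delta>)"
  unfolding models_def
proof (intro conjI ballI allI impI)
  show "is_structure L (completion TS)"
    by (rule TS.is_structure_completion)
  fix \<sigma> and s :: "nat \<Rightarrow> nat \<Rightarrow> ('f + 'm) trm"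
  assume \<sigma>: "\<sigma> \<in> \<Gamma> \<union> \<Delta>" and s: "range s \<subseteq> points (completion TS)"
  then have zero: "\<forall>s. range s \<subseteq> points M \<longrightarrow> fval M s \<sigma> = 0"
    using assms(1) by (simp add: models_def)
  have wf_QSup: "wf_fm L (foldr QSup xs \<phi>) = wf_fm L \<phi>" and wf_QInf: "wf_fm L (foldr QInf xs \<phi>) = wf_fm L \<phi>" for xs \<phi>
    by (induction xs) auto
  consider (univ) xs \<phi> where "\<sigma> = foldr QSup xs \<phi>" "wf_fm L \<phi>" "quantifier_free \<phi>"
    | (ex) xs \<phi> where "\<sigma> = foldr QInf xs \<phi>" "wf_fm L \<phi>" "quantifier_free \<phi>" "fv \<sigma> = {}"
    using \<sigma> \<Gamma> \<Delta> by (auto simp: universal_def existential_def sentences_def wf_QSup wf_QInf subset_iff)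
  then show "fval (completion TS) s \<sigma> = 0"
  proof cases
    case univ
    then show ?thesis
      using universal_sentence_completion[OF univ(2,3) _ s] zero by simp
  next
    case ex
    then show ?thesis
      using existential_sentence_completion[OF ex(2,3) _ _ s] zero by simp
  qed
qed

end

section \<open>Transport along injections into the universe\<close>

text \<open>Axiomatizations and quantifier elimination speak of models with points in the universe
  only. A copy of a structure along an injection into the universe makes them available for
  structures on other types.\<close>

definition transport :: "('a \<Rightarrow> 'u) \<Rightarrow> ('f, 'p, 'a) metric_structure \<Rightarrow> ('f, 'p, 'u) metric_structure" where
  "transport j N =
     \<lparr>points = j ` points N,
      metric = \<lambda>x y. metric N (inv j x) (inv j y),
      fun_interp = \<lambda>F xs. j (fun_interp N F (map (inv j) xs)),
      pred_interp = \<lambda>P xs. pred_interp N P (map (inv j) xs)\<rparr>"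

lemma tval_transport:
  assumes "inj j"
  shows "tval (transport j N) (\<lambda>v. j (s v)) t = j (tval N s t)"
proof (induction t)
  case (App F ts)
  then have "map (inv j) (map (tval (transport j N) (\<lambda>v. j (s v))) ts) = map (tval N s) ts"
    using assms by simp
  then show ?case
    by (simp add: transport_def del: map_map)
qed simp

lemma fval_transport:
  assumes "inj j"
  shows "fval (transport j N) (\<lambda>v. j (s v)) \<phi> = fval N s \<phi>"
proof (induction \<phi> arbitrary: s)
  case (Dist t t')
  then show ?case
    using tval_transport[OF assms, of N s] assms by (simp add: transport_def)
next
  case (Pred P ts)
  have "map (inv j) (map (tval (transport j N) (\<lambda>v. j (s v))) ts) = map (tval N s) ts"
    using tval_transport[OF assms, of N s] assms by simp
  then show ?case
    by (simp add: transport_def del: map_map)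
next
  case (Conn u \<phi>s)
  then have "map (fval (transport j N) (\<lambda>v. j (s v))) \<phi>s = map (fval N s) \<phi>s"
    by simp
  then show ?case
    by (simp only: fval.simps)
next
  case (QSup i \<phi>)
  have upd: "(\<lambda>v. j (s v))(i := j a) = (\<lambda>v. j ((s(i := a)) v))" for a
    by auto
  show ?case
    by (simp add: image_image upd QSup del: fun_upd_apply)
      (simp add: transport_def image_image upd QSup[unfolded transport_def] del: fun_upd_apply)
next
  case (QInf i \<phi>)
  have upd: "(\<lambda>v. j (s v))(i := j a) = (\<lambda>v. j ((s(i := a)) v))" for a
    by auto
  show ?case
    by (simp add: image_image upd QInf del: fun_upd_apply)
      (simp add: transport_def image_image upd QInf[unfolded transport_def] del: fun_upd_apply)
qed

lemma is_structure_transport: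
  assumes j: "inj j" and N: "is_structure L N" and L: "is_signature L"
  shows "is_structure L (transport j N)"
proof -
  let ?d = "metric (transport j N)"
  interpret N: prestructure L N
    using N is_structure_iff_prestructure[OF L] by blast
  interpret N: Metric_space "points N" "metric N"
    using N is_structure_iff_prestructure[OF L] by blast
  have inv_points: "inv j x \<in> points N \<and> j (inv j x) = x" if "x \<in> j ` points N" for x
    using that j by auto
  have points: "points (transport j N) = j ` points N"
    and d: "?d x y = metric N (inv j x) (inv j y)" for x y
    by (simp_all add: transport_def)
  have inv_tuples: "map (inv j) xs \<in> tuples (points N) k" if "xs \<in> tuples (j ` points N) k" for xs k
    using that inv_points by (auto simp: tuples_def subset_iff)
  have close_inv: "\<forall>i<k. metric N (map (inv j) xs ! i) (map (inv j) ys ! i) < r"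
    if "xs \<in> tuples (j ` points N) k" "ys \<in> tuples (j ` points N) k"
      "\<forall>i<k. metric N (inv j (xs ! i)) (inv j (ys ! i)) < r" for xs ys k r
    using that by (simp add: tuples_def)
  have fun_interp: "fun_interp (transport j N) F xs = j (fun_interp N F (map (inv j) xs))"
    and pred_interp: "pred_interp (transport j N) P xs = pred_interp N P (map (inv j) xs)" for F P xs
    by (simp_all add: transport_def)
  have "prestructure L (transport j N)"
  proof (unfold_locales, unfold points d fun_interp pred_interp inv_f_f[OF j])
    fix x y z
    assume x: "x \<in> j ` points N"
    then show "metric N (inv j x) (inv j x) = 0"
      by (simp add: inv_points N.metric_self)
    assume y: "y \<in> j ` points N"
    show "metric N (inv j x) (inv j y) = metric N (inv j y) (inv j x)"
      by (rule N.commute)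
    show "metric N (inv j x) (inv j y) \<le> 1"
      using x y by (simp add: inv_points N.metric_le_1)
    assume z: "z \<in> j ` points N"
    show "metric N (inv j x) (inv j z) \<le> metric N (inv j x) (inv j y) + metric N (inv j y) (inv j z)"
      using x y z by (intro N.triangle) (simp_all add: inv_points)
  next
    fix F xs ys \<epsilon>
    assume F: "F \<in> funs L" and xs: "xs \<in> tuples (j ` points N) (fun_arity L F)"
    then show "j (fun_interp N F (map (inv j) xs)) \<in> j ` points N"
      by (intro imageI N.fun_closed inv_tuples)
    assume "ys \<in> tuples (j ` points N) (fun_arity L F)" "\<epsilon> \<in> {0<..1::real}"
      "\<forall>i<fun_arity L F. metric N (inv j (xs ! i)) (inv j (ys ! i)) < fun_modulus L F \<epsilon>"
    with F xs show "metric N (fun_interp N F (map (inv j) xs)) (fun_interp N F (map (inv j) ys)) \<le> \<epsilon>"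
      by (intro N.fun_ucont inv_tuples close_inv)
  next
    fix P xs ys \<epsilon>
    assume P: "P \<in> preds L" and xs: "xs \<in> tuples (j ` points N) (pred_arity L P)"
    then show "pred_interp N P (map (inv j) xs) \<in> {0..1}"
      by (intro N.pred_unit inv_tuples)
    assume "ys \<in> tuples (j ` points N) (pred_arity L P)" "\<epsilon> \<in> {0<..1::real}"
      "\<forall>i<pred_arity L P. metric N (inv j (xs ! i)) (inv j (ys ! i)) < pred_modulus L P \<epsilon>"
    with P xs show "\<bar>pred_interp N P (map (inv j) xs) - pred_interp N P (map (inv j) ys)\<bar> \<le> \<epsilon>"
      by (intro N.pred_ucont inv_tuples close_inv)
  qed (use N.nonempty L in simp_all)
  moreover interpret T: Metric_space "j ` points N" ?d
    unfolding d
  proof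
    fix x y z
    show "0 \<le> metric N (inv j x) (inv j y)" "metric N (inv j x) (inv j y) = metric N (inv j y) (inv j x)"
      by (rule N.nonneg N.commute)+
    assume x: "x \<in> j ` points N" and y: "y \<in> j ` points N"
    then have "inv j x = inv j y \<longleftrightarrow> x = y"
      by (metis inv_points)
    then show "metric N (inv j x) (inv j y) = 0 \<longleftrightarrow> x = y"
      using x y inv_points N.zero by simp
    assume "z \<in> j ` points N"
    with x y show "metric N (inv j x) (inv j z) \<le> metric N (inv j x) (inv j y) + metric N (inv j y) (inv j z)"
      using inv_points by (intro N.triangle) simp_all
  qed
  have T.mcomplete
    unfolding T.mcomplete_def
  proof (intro allI impI)
    fix \<sigma>
    assume \<sigma>: "T.MCauchy \<sigma>"
    then have mem: "\<sigma> k \<in> j ` points N" for k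
      by (auto simp: T.MCauchy_def)
    have "N.MCauchy (\<lambda>k. inv j (\<sigma> k))"
      using \<sigma> inv_points[OF mem] unfolding T.MCauchy_def N.MCauchy_def d by auto
    then obtain l where l: "limitin N.mtopology (\<lambda>k. inv j (\<sigma> k)) l sequentially"
      using N is_structure_iff_prestructure[OF L] N.mcomplete_def by blast
    then have "limitin T.mtopology \<sigma> (j l) sequentially"
      using mem j unfolding T.limit_metric_sequentially N.limit_metric_sequentially d
      by (auto, meson)
    then show "\<exists>l. limitin T.mtopology \<sigma> l sequentially"
      by blast
  qed
  ultimately show ?thesis
    using T.Metric_space_axioms unfolding is_structure_iff_prestructure[OF L] points by blast
qed

lemma models_transport_iff:
  fixes N :: "('f, 'p, 'a) metric_structure"
  assumes j: "inj (j :: 'a \<Rightarrow> 'b)" and N: "is_structure L N" and L: "is_signature L"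
  shows "models L (transport j N) A \<longleftrightarrow> models L N A"
proof -
  have "(\<forall>s. range s \<subseteq> points (transport j N) \<longrightarrow> fval (transport j N) s \<sigma> = 0) \<longleftrightarrow>
      (\<forall>s. range s \<subseteq> points N \<longrightarrow> fval N s \<sigma> = 0)" for \<sigma>
  proof (intro iffI allI impI)
    fix s :: "nat \<Rightarrow> 'a"
    assume zero: "\<forall>s. range s \<subseteq> points (transport j N) \<longrightarrow> fval (transport j N) s \<sigma> = 0"
      and "range s \<subseteq> points N"
    then have "range (\<lambda>v. j (s v)) \<subseteq> points (transport j N)"
      by (auto simp: transport_def)
    with zero have "fval (transport j N) (\<lambda>v. j (s v)) \<sigma> = 0"
      by blast
    then show "fval N s \<sigma> = 0"
      by (simp only: fval_transport[OF j])
  next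
    fix s :: "nat \<Rightarrow> 'b"
    assume zero: "\<forall>s. range s \<subseteq> points N \<longrightarrow> fval N s \<sigma> = 0"
      and s: "range s \<subseteq> points (transport j N)"
    define r where "r v = inv j (s v)" for v
    have r: "r v \<in> points N \<and> s v = j (r v)" for v
    proof -
      obtain x where "x \<in> points N" "s v = j x"
        using s by (auto simp: transport_def)
      with j show ?thesis
        by (simp add: r_def)
    qed
    then have "s = (\<lambda>v. j (r v))" "range r \<subseteq> points N"
      by auto
    with zero show "fval (transport j N) s \<sigma> = 0"
      by (simp only: fval_transport[OF j])
  qed
  then show ?thesis
    using is_structure_transport[OF j N L] N by (simp add: models_def)
qed

lemma axiomatizes_along_injection:
  fixes N :: "('f, 'p, 'a) metric_structure"
  assumes "axiomatizes TYPE('u) L A T" "inj (j :: 'a \<Rightarrow> 'u)" "is_structure L N" "is_signature L"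
  shows "models L N A \<longleftrightarrow> models L N T"
  using assms(1)[unfolded axiomatizes_def, rule_format, of "transport j N"]
  by (simp only: models_transport_iff[OF assms(2-4)])

lemma approximation_along_injection:
  fixes N :: "('f, 'p, 'a) metric_structure"
  assumes approx: "\<forall>N :: ('f, 'p, 'u) metric_structure. models L N T \<longrightarrow>
      (\<forall>s. range s \<subseteq> points N \<longrightarrow> \<bar>fval N s \<phi> - fval N s \<psi>\<bar> \<le> \<delta>)"
    and j: "inj (j :: 'a \<Rightarrow> 'u)" and L: "is_signature L"
    and N: "models L N T" and s: "range s \<subseteq> points N"
  shows "\<bar>fval N s \<phi> - fval N s \<psi>\<bar> \<le> \<delta>"
proof -
  have "models L (transport j N) T"
    using N models_transport_iff[OF j _ L] by (auto simp: models_def)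
  moreover have "range (\<lambda>v. j (s v)) \<subseteq> points (transport j N)"
    using s by (auto simp: transport_def)
  ultimately have "\<bar>fval (transport j N) (\<lambda>v. j (s v)) \<phi> - fval (transport j N) (\<lambda>v. j (s v)) \<psi>\<bar> \<le> \<delta>"
    using approx by blast
  then show ?thesis
    by (simp add: fval_transport[OF j])
qed

text \<open>A term is determined by its labels at the positions of its syntax tree, a position being the
  list of the argument numbers on the path from the root. The last summand serves twice: \<open>0\<close> marks a
  position outside of the tree, and \<open>Suc v\<close> marks the variable \<open>v\<close>.\<close>

primrec label_at :: "nat list \<Rightarrow> ('f + 'm) trm \<Rightarrow> 'f + 'p + 'm + nat" where
  "label_at [] t = (case t of
      Var v \<Rightarrow> Inr (Inr (Inr (Suc v)))
    | App (Inl F) ts \<Rightarrow> Inl F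
    | App (Inr c) ts \<Rightarrow> Inr (Inr (Inl c)))"
| "label_at (i # p) t = (case t of
      Var v \<Rightarrow> Inr (Inr (Inr 0))
    | App F ts \<Rightarrow> (if i < length ts then label_at p (ts ! i) else Inr (Inr (Inr 0))))"

lemma label_at_root_nonzero: "label_at [] t \<noteq> Inr (Inr (Inr 0))"
  by (auto split: trm.split sum.split)

lemma label_at_inject:
  assumes "\<And>p. (label_at p t :: 'f + 'p + 'm + nat) = label_at p t'"
  shows "t = t'"
  using assms
proof (induction t arbitrary: t')
  case (Var v)
  from Var[of "[]"] show ?case
    by (auto split: trm.splits sum.splits)
next
  case (App F ts)
  from App.prems[of "[]"] obtain ts' where t': "t' = App F ts'"
    by (auto split: trm.splits sum.splits)
  have root: "(label_at [] u :: 'f + 'p + 'm + nat) \<noteq> Inr (Inr (Inr 0))" for u :: "('f + 'm) trm"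
    by (rule label_at_root_nonzero)
  have "i < length ts \<longleftrightarrow> i < length ts'" for i
    using App.prems[of "[i]"] root[of "ts ! i"] root[of "ts' ! i"]
    unfolding t' by (auto simp del: label_at.simps(1) split: if_splits)
  then have len: "length ts = length ts'"
    by (meson linorder_neqE_nat order_less_irrefl)
  have "ts ! i = ts' ! i" if "i < length ts" for i
  proof (rule App.IH)
    show "ts ! i \<in> set ts"
      using that by simp
    show "label_at p (ts ! i) = (label_at p (ts' ! i) :: 'f + 'p + 'm + nat)" for p
      using App.prems[of "i # p"] that len by (simp add: t')
  qed
  then show ?case
    using len by (simp add: t' list_eq_iff_nth_eq)
qed

definition point_code :: "'m \<Rightarrow> ('f, 'p, 'm) universe" where
  "point_code x = (\<lambda>_. Inr (Inr (Inl x)))"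

lemma inj_point_code: "inj point_code"
  by (auto simp: inj_def point_code_def fun_eq_iff)

text \<open>Pairs of an index and a position are countable, so one function on \<open>nat\<close> records all the
  labels of all the terms of a sequence.\<close>

definition term_sequence_code :: "(nat \<Rightarrow> ('f + 'm) trm) \<Rightarrow> ('f, 'p, 'm) universe" where
  "term_sequence_code s = (\<lambda>m. let kp = from_nat m :: nat \<times> nat list in label_at (snd kp) (s (fst kp)))"

lemma inj_term_sequence_code:
  "inj (term_sequence_code :: (nat \<Rightarrow> ('f + 'm) trm) \<Rightarrow> ('f, 'p, 'm) universe)"
proof (rule injI, rule ext)
  fix s s' :: "nat \<Rightarrow> ('f + 'm) trm" and k
  assume eq: "term_sequence_code s = (term_sequence_code s' :: ('f, 'p, 'm) universe)"
  have "(label_at p (s k) :: 'f + 'p + 'm + nat) = label_at p (s' k)" for p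
    using fun_cong[OF eq, of "to_nat (k, p)"] by (simp add: term_sequence_code_def)
  then show "s k = s' k"
    by (rule label_at_inject)
qed

section \<open>Parameters as variables\<close>

fun generalize_trm :: "('m \<Rightarrow> nat) \<Rightarrow> ('f + 'm) trm \<Rightarrow> 'f trm" where
  "generalize_trm v (Var i) = Var i"
| "generalize_trm v (App (Inl F) ts) = App F (map (generalize_trm v) ts)"
| "generalize_trm v (App (Inr c) ts) = Var (v c)"

fun generalize_fm :: "('m \<Rightarrow> nat) \<Rightarrow> ('f + 'm, 'p) fm \<Rightarrow> ('f, 'p) fm" where
  "generalize_fm v (Dist t t') = Dist (generalize_trm v t) (generalize_trm v t')"
| "generalize_fm v (Pred P ts) = Pred P (map (generalize_trm v) ts)"
| "generalize_fm v (Conn u \<phi>s) = Conn u (map (generalize_fm v) \<phi>s)"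
| "generalize_fm v (QSup i \<phi>) = QSup i (generalize_fm v \<phi>)"
| "generalize_fm v (QInf i \<phi>) = QInf i (generalize_fm v \<phi>)"

fun bound_vars :: "('f, 'p) fm \<Rightarrow> nat set" where
  "bound_vars (Dist t t') = {}"
| "bound_vars (Pred P ts) = {}"
| "bound_vars (Conn u \<phi>s) = (\<Union>\<phi>\<in>set \<phi>s. bound_vars \<phi>)"
| "bound_vars (QSup i \<phi>) = insert i (bound_vars \<phi>)"
| "bound_vars (QInf i \<phi>) = insert i (bound_vars \<phi>)"

lemma finite_bound_vars: "finite (bound_vars \<phi>)"
  by (induction \<phi>) auto

lemma finite_symbols_trm: "finite (set_trm t)"
  by (induction t) auto

lemma finite_symbols_fm: "finite (set1_fm \<phi>)"
  by (induction \<phi>) (auto simp: finite_symbols_trm)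

lemma wf_generalize_trm: "wf_trm (sig_consts L A) t \<Longrightarrow> wf_trm L (generalize_trm v t)"
  by (induction v t rule: generalize_trm.induct) (auto simp: sig_consts_def)

lemma wf_generalize_fm: "wf_fm (sig_consts L A) \<phi> \<Longrightarrow> wf_fm L (generalize_fm v \<phi>)"
  by (induction v \<phi> rule: generalize_fm.induct) (auto simp: wf_generalize_trm, auto simp: sig_consts_def)

lemma constants_trm: "wf_trm (sig_consts L A) t \<Longrightarrow> Inr c \<in> set_trm t \<Longrightarrow> c \<in> A"
  by (induction t) (auto simp: sig_consts_def)

lemma constants_fm: "wf_fm (sig_consts L A) \<phi> \<Longrightarrow> Inr c \<in> set1_fm \<phi> \<Longrightarrow> c \<in> A"
  by (induction \<phi>) (auto dest: constants_trm)

lemma tval_generalize: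
  "(\<And>c. Inr c \<in> set_trm t \<Longrightarrow> s (v c) = c) \<Longrightarrow> tval M s (generalize_trm v t) = tval (struct_consts M) s t"
proof (induction v t rule: generalize_trm.induct)
  case (2 v F ts)
  then have "map (tval M s) (map (generalize_trm v) ts) = map (tval (struct_consts M) s) ts"
    by (auto intro!: "2.IH")
  then show ?case
    by (simp add: struct_consts_def del: map_map)
qed (simp_all add: struct_consts_def)

lemma fval_generalize:
  "bound_vars \<phi> \<subseteq> {..<B} \<Longrightarrow> (\<And>c. B \<le> v c) \<Longrightarrow> (\<And>c. Inr c \<in> set1_fm \<phi> \<Longrightarrow> s (v c) = c)
    \<Longrightarrow> fval M s (generalize_fm v \<phi>) = fval (struct_consts M) s \<phi>"
proof (induction \<phi> arbitrary: s)
  case (Dist t t')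
  then show ?case
    using tval_generalize[of t s v M] tval_generalize[of t' s v M] by (simp add: struct_consts_def)
next
  case (Pred P ts)
  then have "map (tval M s) (map (generalize_trm v) ts) = map (tval (struct_consts M) s) ts"
    by (auto intro!: tval_generalize)
  then show ?case
    by (simp add: struct_consts_def del: map_map)
next
  case (Conn u \<phi>s)
  then have "map (fval M s) (map (generalize_fm v) \<phi>s) = map (fval (struct_consts M) s) \<phi>s"
    unfolding map_map o_def
  proof (intro map_cong refl Conn.IH)
    fix \<phi> c
    assume "\<phi> \<in> set \<phi>s"
    then show "bound_vars \<phi> \<subseteq> {..<B}"
      using Conn.prems(1) by auto
    assume "Inr c \<in> set1_fm \<phi>"
    with \<open>\<phi> \<in> set \<phi>s\<close> show "s (v c) = c"
      by (intro Conn.prems(3)) auto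
  qed (use Conn.prems(2) in auto)
  then show ?case
    by (simp only: fval.simps generalize_fm.simps)
next
  case (QSup i \<phi>)
  have "i \<noteq> v c" for c
    using QSup.prems(1) QSup.prems(2)[of c] by auto
  then have "fval M (s(i := a)) (generalize_fm v \<phi>) = fval (struct_consts M) (s(i := a)) \<phi>" for a
    using QSup.prems by (intro QSup.IH) auto
  then show ?case
    by (simp add: struct_consts_def)
next
  case (QInf i \<phi>)
  have "i \<noteq> v c" for c
    using QInf.prems(1) QInf.prems(2)[of c] by auto
  then have "fval M (s(i := a)) (generalize_fm v \<phi>) = fval (struct_consts M) (s(i := a)) \<phi>" for a
    using QInf.prems by (intro QInf.IH) auto
  then show ?case
    by (simp add: struct_consts_def)
qed

text \<open>An \<open>L(M)\<close>-formula is an \<open>L\<close>-formula with some variables held at fixed points, because only finitely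
  many constants occur in it. The variables from \<open>B\<close> on carry the constants; \<open>B\<close> exceeds all bound
  variables, which prevents capture, and also \<open>B\<^sub>0\<close>, so that the first variables
  stay at the disposal of the formula.\<close>

lemma parameters_as_variables:
  assumes wf: "wf_fm (sig_consts L (points M)) \<phi>" and "points M \<noteq> {}"
  obtains \<phi>' g B where "wf_fm L \<phi>'" "range g \<subseteq> points M" "B\<^sub>0 \<le> B"
    "\<And>s. (\<And>i. B \<le> i \<Longrightarrow> s i = g i) \<Longrightarrow> fval M s \<phi>' = fval (struct_consts M) s \<phi>"
proof -
  obtain x0 where x0: "x0 \<in> points M"
    using assms(2) by blast
  define C where "C = {c. Inr c \<in> set1_fm \<phi>}"
  have "finite C"
    unfolding C_def using finite_symbols_fm[of \<phi>] finite_vimageI[of "set1_fm \<phi>" Inr]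
    by (simp add: vimage_def)
  obtain B1 where B1: "bound_vars \<phi> \<subseteq> {..<B1}"
    using finite_bound_vars[of \<phi>] finite_nat_iff_bounded by blast
  define B where "B = max B\<^sub>0 B1"
  define v where "v c = B + to_nat_on C c" for c
  have "inj_on v C"
    unfolding v_def using inj_on_to_nat_on[OF countable_finite[OF \<open>finite C\<close>]] by (simp add: inj_on_def)
  define g where "g i = (if i \<in> v ` C then inv_into C v i else x0)" for i
  have g: "g (v c) = c" if "c \<in> C" for c
    using that \<open>inj_on v C\<close> by (simp add: g_def)
  have "C \<subseteq> points M"
    using constants_fm[OF wf] by (auto simp: C_def)
  then have "range g \<subseteq> points M"
    using x0 inv_into_into[of _ v C] by (auto simp: g_def)
  moreover have "fval M s (generalize_fm v \<phi>) = fval (struct_consts M) s \<phi>" if "\<And>i. B \<le> i \<Longrightarrow> s i = g i" for s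
  proof (rule fval_generalize)
    show "bound_vars \<phi> \<subseteq> {..<B}"
      using B1 by (auto simp: B_def)
    show v: "B \<le> v c" for c
      by (simp add: v_def)
    show "s (v c) = c" if "Inr c \<in> set1_fm \<phi>" for c
      using \<open>\<And>i. B \<le> i \<Longrightarrow> s i = g i\<close>[OF v] g[of c] that by (simp add: C_def)
  qed
  ultimately show thesis
    using that[of "generalize_fm v \<phi>" g B] wf_generalize_fm[OF wf] by (auto simp: B_def)
qed

section \<open>Terms as approximate witnesses\<close>

context term_limit
begin

text \<open>The heart of the argument. That the infimum over \<open>y\<close> is small is transferred from \<open>M\<close> to the completion by
  way of the quantifier-free \<open>\<theta>\<close>. There the infimum is nearly attained, and since the terms are dense,
  it is nearly attained at a term. This goes back to \<open>M\<close> by way of the quantifier-free \<open>\<psi>\<close>. Each of the two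
  approximations is used twice, and the choice of a point near the infimum costs one more \<open>\<delta>\<close>.\<close>

lemma eventually_witness_term:
  assumes \<phi>: "wf_fm L \<phi>" and \<psi>: "wf_fm L \<psi>" "quantifier_free \<psi>" and \<theta>: "wf_fm L \<theta>" "quantifier_free \<theta>"
    and \<psi>_M: "\<And>s. range s \<subseteq> points M \<Longrightarrow> \<bar>fval M s \<phi> - fval M s \<psi>\<bar> \<le> \<delta>"
    and \<theta>_M: "\<And>s. range s \<subseteq> points M \<Longrightarrow> \<bar>fval M s (QInf y \<phi>) - fval M s \<theta>\<bar> \<le> \<delta>"
    and \<psi>_C: "\<And>s. range s \<subseteq> points (completion TS) \<Longrightarrow>
      \<bar>fval (completion TS) s \<phi> - fval (completion TS) s \<psi>\<bar> \<le> \<delta>"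
    and \<theta>_C: "\<And>s. range s \<subseteq> points (completion TS) \<Longrightarrow>
      \<bar>fval (completion TS) s (QInf y \<phi>) - fval (completion TS) s \<theta>\<bar> \<le> \<delta>"
    and "0 < \<delta>" and \<tau>: "range \<tau> \<subseteq> param_terms L M n"
    and small: "\<forall>\<^sub>F as in G. fval M (\<lambda>v. eval_at M as (\<tau> v)) (QInf y \<phi>) \<le> r"
  obtains t where "t \<in> param_terms L M n"
    "\<forall>\<^sub>F as in G. fval M ((\<lambda>v. eval_at M as (\<tau> v))(y := eval_at M as t)) \<phi> < r + 5 * \<delta>"
proof -
  interpret C: prestructure L "completion TS"
    by (rule TS.prestructure_completion)
  have eval_points: "\<forall>\<^sub>F as in G. range (\<lambda>v. eval_at M as (\<tau> v)) \<subseteq> points M"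
    if "range \<tau> \<subseteq> param_terms L M n" for \<tau>
    using G_tuples by eventually_elim (use that in \<open>auto intro: M.eval_at_in_points\<close>)
  define \<sigma> where "\<sigma> v = limit_point TS (\<lambda>_. \<tau> v)" for v
  have const: "(\<lambda>_. \<tau> v) \<in> cauchy_seqs TS" for v
    using \<tau> by (intro TS.const_cauchy_seq) auto
  then have \<sigma>: "range \<sigma> \<subseteq> points (completion TS)"
    by (auto simp: \<sigma>_def intro: TS.limit_point_in_completion)
  have "\<forall>\<^sub>F as in G. fval M (\<lambda>v. eval_at M as (\<tau> v)) \<theta> \<le> r + \<delta>"
    using small eval_points[OF \<tau>] by eventually_elim (use \<theta>_M in fastforce)
  then have "fval TS \<tau> \<theta> \<le> r + \<delta>"
    by (rule tendsto_upperbound[OF fval_TS_lim[OF \<tau> \<theta>] _ G_proper])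
  then have "fval (completion TS) \<sigma> \<theta> \<le> r + \<delta>"
    unfolding \<sigma>_def by (simp add: fval_completion_constant_terms[OF \<tau> \<theta>])
  then have "fval (completion TS) \<sigma> (QInf y \<phi>) < r + 3 * \<delta>"
    using \<theta>_C[OF \<sigma>] \<open>0 < \<delta>\<close> by linarith
  then have "(INF a\<in>points (completion TS). fval (completion TS) (\<sigma>(y := a)) \<phi>) < r + 3 * \<delta>"
    by simp
  then obtain p where p: "p \<in> points (completion TS)" "fval (completion TS) (\<sigma>(y := p)) \<phi> < r + 3 * \<delta>"
    using C.nonempty by (auto dest!: cInf_lessD[rotated])
  then have "fval (completion TS) (\<sigma>(y := p)) \<psi> < r + 4 * \<delta>"
    using \<psi>_C[of "\<sigma>(y := p)"] \<sigma> by fastforce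
  moreover have p': "p \<in> cauchy_seqs TS" "limit_point TS p = p"
    using p(1) TS.points_completion by auto
  define \<Sigma> where "\<Sigma> = (\<lambda>v _. \<tau> v)(y := p)"
  have \<Sigma>: "\<Sigma> v \<in> cauchy_seqs TS" for v
    using const p'(1) by (simp add: \<Sigma>_def)
  have "(\<lambda>v. limit_point TS (\<Sigma> v)) = \<sigma>(y := p)" "(\<lambda>v. \<Sigma> v k) = \<tau>(y := p k)" for k
    by (auto simp: \<Sigma>_def \<sigma>_def p'(2))
  then have "(\<lambda>k. fval TS (\<tau>(y := p k)) \<psi>) \<longlonglongrightarrow> fval (completion TS) (\<sigma>(y := p)) \<psi>"
    using TS.fval_completion_lim[of \<Sigma>, OF \<Sigma> \<psi>] by simp
  ultimately have "\<forall>\<^sub>F k in sequentially. fval TS (\<tau>(y := p k)) \<psi> < r + 4 * \<delta>"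
    by (rule order_tendstoD(2)[rotated])
  then obtain k where k: "fval TS (\<tau>(y := p k)) \<psi> < r + 4 * \<delta>"
    by (auto simp: eventually_sequentially)
  have pk: "p k \<in> param_terms L M n"
    using TS.cauchy_seqsD[OF p'(1)] by simp
  then have \<tau>': "range (\<tau>(y := p k)) \<subseteq> param_terms L M n"
    using \<tau> by auto
  have upd: "(\<lambda>v. eval_at M as ((\<tau>(y := p k)) v)) = (\<lambda>v. eval_at M as (\<tau> v))(y := eval_at M as (p k))" for as
    by auto
  have "\<forall>\<^sub>F as in G. fval M (\<lambda>v. eval_at M as ((\<tau>(y := p k)) v)) \<psi> < r + 4 * \<delta>"
    by (rule order_tendstoD(2)[OF fval_TS_lim[OF \<tau>' \<psi>] k])
  then have "\<forall>\<^sub>F as in G. fval M (\<lambda>v. eval_at M as ((\<tau>(y := p k)) v)) \<phi> < r + 5 * \<delta>"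
    using eval_points[OF \<tau>'] by eventually_elim (use \<psi>_M in fastforce)
  then show thesis
    using that[OF pk] by (simp only: upd)
qed

end

lemma (in prestructure) term_limit_subfilter:
  fixes n :: nat
  assumes "F \<noteq> bot" and tup: "\<forall>\<^sub>F as in F. as \<in> tuples (points N) n"
  obtains G where "G \<le> F" "term_limit L N n G"
proof -
  define I :: "('f + 'a, 'p) fm set" where
    "I = {Dist t t' | t t'. t \<in> param_terms L N n \<and> t' \<in> param_terms L N n} \<union>
      {Pred P ts | P ts. P \<in> preds L \<and> ts \<in> tuples (param_terms L N n) (pred_arity L P)}"
  have Dist: "fval (struct_consts N) ((!) as) (Dist t t') = metric N (eval_at N as t) (eval_at N as t')"
    and Pred: "fval (struct_consts N) ((!) as) (Pred P ts) = pred_interp N P (map (eval_at N as) ts)" for as t t' P ts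
    by (simp_all add: eval_at_def struct_consts_def)
  have "\<forall>\<^sub>F as in F. \<forall>i\<in>I. fval (struct_consts N) ((!) as) i \<in> {0..1}"
    using tup
  proof eventually_elim
    case (elim as)
    then have "map (eval_at N as) ts \<in> tuples (points N) k" if "ts \<in> tuples (param_terms L N n) k" for ts k
      using that by (auto simp: tuples_def[of "param_terms L N n"] intro!: map_in_tuples eval_at_in_points)
    with elim show ?case
      using eval_at_in_points metric_nonneg metric_le_1 pred_unit
      unfolding I_def by (auto simp: Dist Pred simp del: fval.simps)
  qed
  from convergent_subfilter[OF assms(1) this] obtain G where G: "G \<le> F" "G \<noteq> bot"
    "\<And>i. i \<in> I \<Longrightarrow> \<exists>l. ((\<lambda>as. fval (struct_consts N) ((!) as) i) \<longlongrightarrow> l) G"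
    by blast
  have "term_limit L N n G"
  proof
    show "\<forall>\<^sub>F as in G. as \<in> tuples (points N) n"
      using G(1) tup by (rule filter_leD)
    show "\<exists>l. ((\<lambda>as. metric N (eval_at N as t) (eval_at N as t')) \<longlongrightarrow> l) G"
      if "t \<in> param_terms L N n" "t' \<in> param_terms L N n" for t t'
      using G(3)[of "Dist t t'"] that unfolding Dist I_def by blast
    show "\<exists>l. ((\<lambda>as. pred_interp N P (map (eval_at N as) ts)) \<longlongrightarrow> l) G"
      if "P \<in> preds L" "ts \<in> tuples (param_terms L N n) (pred_arity L P)" for P ts
      using G(3)[of "Pred P ts"] that unfolding Pred I_def by blast
  qed (rule G(2))
  with G(1) show thesis
    using that by blast
qed

theorem proposition3p4:
  fixes L :: "('f, 'p) signature"
    and T :: "('f, 'p) fm set"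
    and M :: "('f, 'p, 'm) metric_structure"
    and n :: nat
    and f :: "'m list \<Rightarrow> 'm"
    and \<epsilon> :: real
  assumes "is_signature L"
    and "is_theory L T"
    and "primitive TYPE(('f, 'p, 'm) universe) L T"
    and "admits_QE TYPE(('f, 'p, 'm) universe) L T"
    and "models L M T"
    and "definable_function L M n f"
    and "\<epsilon> > 0"
  shows "\<exists>ts :: ('f + 'm) trm set. finite ts \<and>
           (\<forall>t\<in>ts. wf_trm (sig_consts L (points M)) t \<and> fv_trm t \<subseteq> {..<n}) \<and>
           (\<forall>as\<in>tuples (points M) n. \<exists>t\<in>ts.
              metric M (f as) (tval (struct_consts M) ((!) as) t) \<le> \<epsilon>)"
proof (rule ccontr)
  assume no_terms: "\<not> ?thesis"
  note L = \<open>is_signature L\<close>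
  have M: "is_structure L M"
    using \<open>models L M T\<close> by (simp add: models_def)
  then interpret M: prestructure L M
    using is_structure_iff_prestructure[OF L] by blast

  \<comment> \<open>Without such a finite set, the tuples at which \<open>f\<close> is far from a given term generate a proper filter.\<close>
  define far where "far t = {as \<in> tuples (points M) n. \<epsilon> < metric M (f as) (eval_at M as t)}" for t
  define F where "F = (INF t\<in>param_terms L M n. principal (far t))"
  have "F \<noteq> bot"
    unfolding F_def
  proof (rule INF_filter_not_bot)
    fix ts :: "('f + 'm) trm set"
    assume ts: "ts \<subseteq> param_terms L M n" "finite ts"
    with no_terms have "\<exists>as\<in>tuples (points M) n. \<forall>t\<in>ts. \<epsilon> < metric M (f as) (eval_at M as t)"
      by (fastforce simp: param_terms_def eval_at_def not_le)
    then obtain as where "\<And>t. t \<in> ts \<Longrightarrow> as \<in> far t"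
      by (auto simp: far_def)
    then show "(INF t\<in>ts. principal (far t)) \<noteq> bot"
      using ts(2) by (auto simp: INF_principal_finite principal_eq_bot_iff)
  qed
  have eventually_far: "\<forall>\<^sub>F as in F. as \<in> far t" if "t \<in> param_terms L M n" for t
    unfolding F_def using that by (intro eventually_INF1[of t]) (auto simp: eventually_principal)
  have "\<forall>\<^sub>F as in F. as \<in> tuples (points M) n"
  proof -
    obtain c where "c \<in> points M"
      using M.nonempty by blast
    then have "App (Inr c) [] \<in> param_terms L M n"
      by simp
    from eventually_far[OF this] show ?thesis
      by (rule eventually_mono) (simp add: far_def)
  qed
  then obtain G where "G \<le> F" "term_limit L M n G"
    using M.term_limit_subfilter[OF \<open>F \<noteq> bot\<close>] by blast
  interpret G: term_limit L M n G
    by fact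
  let ?N = "completion (term_structure L M n G)"

  let ?j\<^sub>M = "point_code :: 'm \<Rightarrow> ('f, 'p, 'm) universe"
  let ?j\<^sub>N = "term_sequence_code :: (nat \<Rightarrow> ('f + 'm) trm) \<Rightarrow> ('f, 'p, 'm) universe"
  have inj: "inj ?j\<^sub>M" "inj ?j\<^sub>N"
    by (rule inj_point_code inj_term_sequence_code)+

  have "models L ?N T"
  proof -
    obtain \<Gamma> \<Delta> where \<Gamma>\<Delta>: "\<Gamma> \<subseteq> {\<sigma> \<in> sentences L. universal \<sigma>}" "\<Delta> \<subseteq> {\<sigma> \<in> sentences L. existential \<sigma>}"
      and ax: "axiomatizes TYPE(('f, 'p, 'm) universe) L (\<Gamma> \<union> \<Delta>) T"
      using \<open>primitive TYPE(('f, 'p, 'm) universe) L T\<close> by (auto simp: primitive_def)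
    have "models L M (\<Gamma> \<union> \<Delta>)"
      using axiomatizes_along_injection[OF ax inj(1) M L] \<open>models L M T\<close> by simp
    then have "models L ?N (\<Gamma> \<union> \<Delta>)"
      using \<Gamma>\<Delta> by (rule G.models_completion)
    then show ?thesis
      using axiomatizes_along_injection[OF ax inj(2) G.TS.is_structure_completion L] by simp
  qed

  \<comment> \<open>The witness lemma costs \<open>5 * \<delta>\<close> beyond the bound \<open>\<delta>\<close> on the infimum, and replacing \<open>\<phi>\<close> by
    the distance to \<open>f as\<close> costs one more \<open>\<delta>\<close>.\<close>
  define \<delta> where "\<delta> = \<epsilon> / 7"
  have "0 < \<delta>"
    using \<open>\<epsilon> > 0\<close> by (simp add: \<delta>_def)
  have QE: "\<exists>\<psi>. wf_fm L \<psi> \<and> quantifier_free \<psi> \<and>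
      (\<forall>s. range s \<subseteq> points M \<longrightarrow> \<bar>fval M s \<phi> - fval M s \<psi>\<bar> \<le> \<delta>) \<and>
      (\<forall>s. range s \<subseteq> points ?N \<longrightarrow> \<bar>fval ?N s \<phi> - fval ?N s \<psi>\<bar> \<le> \<delta>)" if wf: "wf_fm L \<phi>" for \<phi>
  proof -
    obtain \<psi> where \<psi>: "wf_fm L \<psi>" "quantifier_free \<psi>" "\<forall>N :: ('f, 'p, ('f, 'p, 'm) universe) metric_structure.
        models L N T \<longrightarrow> (\<forall>s. range s \<subseteq> points N \<longrightarrow> \<bar>fval N s \<phi> - fval N s \<psi>\<bar> \<le> \<delta>)"
      using \<open>admits_QE TYPE(('f, 'p, 'm) universe) L T\<close>[unfolded admits_QE_def, rule_format, OF wf \<open>0 < \<delta>\<close>]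
      by blast
    then show ?thesis
      using approximation_along_injection[OF \<psi>(3) inj(1) L \<open>models L M T\<close>]
        approximation_along_injection[OF \<psi>(3) inj(2) L \<open>models L ?N T\<close>] by blast
  qed

  obtain \<phi>\<^sub>0 where \<phi>\<^sub>0: "wf_fm (sig_consts L (points M)) \<phi>\<^sub>0" "fv \<phi>\<^sub>0 \<subseteq> {..<Suc n}"
    and \<phi>\<^sub>0_close: "\<And>bs. bs \<in> tuples (points M) (Suc n) \<Longrightarrow>
      \<bar>fval (struct_consts M) ((!) bs) \<phi>\<^sub>0 - metric M (f (take n bs)) (bs ! n)\<bar> < \<delta>"
  proof -
    obtain \<Phi> where \<Phi>: "\<And>j. wf_fm (sig_consts L (points M)) (\<Phi> j) \<and> fv (\<Phi> j) \<subseteq> {..<Suc n}"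
      and lim: "uniform_limit (tuples (points M) (Suc n)) (\<lambda>j bs. fval (struct_consts M) ((!) bs) (\<Phi> j))
        (\<lambda>bs. metric M (f (take n bs)) (bs ! n)) sequentially"
      using \<open>definable_function L M n f\<close> unfolding definable_function_def definable_predicate_def by blast
    obtain j where "\<forall>bs\<in>tuples (points M) (Suc n).
        dist (fval (struct_consts M) ((!) bs) (\<Phi> j)) (metric M (f (take n bs)) (bs ! n)) < \<delta>"
      using uniform_limitD[OF lim \<open>0 < \<delta>\<close>] by (auto simp: eventually_sequentially)
    with \<Phi>[of j] show thesis
      using that[of "\<Phi> j"] by (simp add: dist_real_def)
  qed
  obtain \<phi> g B where \<phi>: "wf_fm L \<phi>" and g: "range g \<subseteq> points M" and "Suc n \<le> B"
    and \<phi>_eq: "\<And>s. (\<And>i. B \<le> i \<Longrightarrow> s i = g i) \<Longrightarrow> fval M s \<phi> = fval (struct_consts M) s \<phi>\<^sub>0"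
    using parameters_as_variables[OF \<phi>\<^sub>0(1) M.nonempty, of "Suc n"] by blast

  \<comment> \<open>The variables below \<open>n\<close> become the generic tuple; all others are held at the constants that
    \<open>\<phi>\<close> refers to.\<close>
  define \<tau> :: "nat \<Rightarrow> ('f + 'm) trm" where "\<tau> v = (if v < n then Var v else App (Inr (g v)) [])" for v
  have \<tau>: "range \<tau> \<subseteq> param_terms L M n"
    using range_subsetD[OF g] by (auto simp: \<tau>_def)
  define s where "s as v = eval_at M as (\<tau> v)" for as v
  have s: "s as v = (if v < n then as ! v else g v)" for as v
    by (simp add: s_def \<tau>_def)
  have \<phi>_close: "\<bar>fval M ((s as)(n := b)) \<phi> - metric M (f as) b\<bar> < \<delta>"
    if as: "as \<in> tuples (points M) n" and b: "b \<in> points M" for as b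
  proof -
    have len: "length as = n"
      using as by (simp add: tuples_def)
    have "fval M ((s as)(n := b)) \<phi> = fval (struct_consts M) ((s as)(n := b)) \<phi>\<^sub>0"
      using \<open>Suc n \<le> B\<close> by (intro \<phi>_eq) (simp add: s)
    also have "\<dots> = fval (struct_consts M) ((!) (as @ [b])) \<phi>\<^sub>0"
      using \<phi>\<^sub>0(2) len by (intro fval_cong) (auto simp: s nth_append subset_iff less_Suc_eq)
    finally show ?thesis
      using \<phi>\<^sub>0_close[of "as @ [b]"] as b len by (auto simp: tuples_def)
  qed
  have f_points: "f as \<in> points M" if "as \<in> tuples (points M) n" for as
    using that \<open>definable_function L M n f\<close> by (auto simp: definable_function_def)
  have small: "\<forall>\<^sub>F as in G. fval M (\<lambda>v. eval_at M as (\<tau> v)) (QInf n \<phi>) \<le> \<delta>"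
    using G.G_tuples
  proof eventually_elim
    case (elim as)
    have "range (s as) \<subseteq> points M"
      using \<tau> elim unfolding s_def by (auto intro: M.eval_at_in_points)
    then have "fval M (s as) (QInf n \<phi>) \<le> fval M ((s as)(n := f as)) \<phi>"
      by (rule M.fval_inf_le_instance[OF \<phi> _ f_points[OF elim]])
    also have "\<dots> \<le> \<delta>"
      using \<phi>_close[OF elim f_points[OF elim]] M.metric_self[OF f_points[OF elim]] by linarith
    finally show ?case
      by (simp only: s_def[abs_def])
  qed
  obtain \<psi> where \<psi>: "wf_fm L \<psi>" "quantifier_free \<psi>"
    "\<And>s. range s \<subseteq> points M \<Longrightarrow> \<bar>fval M s \<phi> - fval M s \<psi>\<bar> \<le> \<delta>"
    "\<And>s. range s \<subseteq> points ?N \<Longrightarrow> \<bar>fval ?N s \<phi> - fval ?N s \<psi>\<bar> \<le> \<delta>"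
    using QE[OF \<phi>] by blast
  have "wf_fm L (QInf n \<phi>)"
    using \<phi> by simp
  from QE[OF this] obtain \<theta> where \<theta>: "wf_fm L \<theta>" "quantifier_free \<theta>"
    "\<And>s. range s \<subseteq> points M \<Longrightarrow> \<bar>fval M s (QInf n \<phi>) - fval M s \<theta>\<bar> \<le> \<delta>"
    "\<And>s. range s \<subseteq> points ?N \<Longrightarrow> \<bar>fval ?N s (QInf n \<phi>) - fval ?N s \<theta>\<bar> \<le> \<delta>"
    by blast
  obtain t where t: "t \<in> param_terms L M n"
    and witness: "\<forall>\<^sub>F as in G. fval M ((\<lambda>v. eval_at M as (\<tau> v))(n := eval_at M as t)) \<phi> < \<delta> + 5 * \<delta>"
    by (rule G.eventually_witness_term[OF \<phi> \<psi>(1,2) \<theta>(1,2) \<psi>(3) \<theta>(3) \<psi>(4) \<theta>(4) \<open>0 < \<delta>\<close> \<tau> small])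
  have "\<forall>\<^sub>F as in G. False"
    using witness filter_leD[OF \<open>G \<le> F\<close> eventually_far[OF t]]
  proof eventually_elim
    case (elim as)
    then have as: "as \<in> tuples (points M) n" and "\<epsilon> < metric M (f as) (eval_at M as t)"
      by (auto simp: far_def)
    moreover have "fval M ((s as)(n := eval_at M as t)) \<phi> < 6 * \<delta>"
      using elim(1) by (simp add: s_def[abs_def])
    moreover have "7 * \<delta> = \<epsilon>"
      by (simp add: \<delta>_def)
    ultimately show ?case
      using \<phi>_close[OF as M.eval_at_in_points[OF t as]] by linarith
  qed
  then show False
    using G.G_proper by (simp add: trivial_limit_def)
qed

end
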